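(* Let $K:\mathbb D\times\mathbb D\to\mathcal M_n(\mathbb C)$ be a positive definite kernel, and suppose that the multiplication operator $M_z$ on $(\mathcal H,K)$ is bounded. If for each $\varphi\in$ Möb there exists a function $g_\varphi\in\mathrm{Hol}(\mathbb D,GL_n(\mathbb C))$ such that the operator $M_{g_\varphi}C_{\varphi^{-1}}$ on $(\mathcal H,K)$ is bounded and invertible, then $M_z$ on $(\mathcal H,K)$ is weakly homogeneous. Moreover, if $K$ is sharp and the operator $M_z$ on $(\mathcal H,K)$ is weakly homogeneous, then for each $\varphi\in$ Möb there exists $g_\varphi\in\mathrm{Hol}(\mathbb D,GL_n(\mathbb C))$ such that the weighted composition operator $M_{g_\varphi}C_{\varphi^{-1}}$ on $(\mathcal H,K)$ is bounded and invertible.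
   Context: $\mathbb D$ is the open unit disc; Möb is the group of all biholomorphic automorphisms of $\mathbb D$. A bounded operator $T$ is weakly homogeneous if $\sigma(T)\subseteq\overline{\mathbb D}$ and $\varphi(T)$ (holomorphic functional calculus) is similar to $T$, i.e. $\varphi(T)=LTL^{-1}$ for some bounded invertible $L$, for all $\varphi\in$ Möb. A kernel $K:\mathbb D\times\mathbb D\to\mathcal M_n(\mathbb C)$ (holomorphic in the first variable, anti-holomorphic in the second) is positive definite if for all finite sets of distinct points $w_1,\dots,w_l\in\mathbb D$ the block matrix $(K(w_i,w_j))_{i,j=1}^l$ is non-negative definite and invertible. $(\mathcal H,K)$ is the associated reproducing kernel Hilbert space of $\mathbb C^n$-valued holomorphic functions, with $\langle f,K(\cdot,w)\eta\rangle=\langle f(w),\eta\rangle_{\mathbb C^n}$. $M_z$ is multiplication by the coordinate function. $K$ is called sharp if $M_z$ is bounded on $(\mathcal H,K)$ and $\ker(M_z^*-\bar w)=\{K(\cdot,w)\eta:\eta\in\mathbb C^n\}$ for all $w\in\mathbb D$. $\mathrm{Hol}(\mathbb D,GL_n(\mathbb C))$ is the set of holomorphic $GL_n(\mathbb C)$-valued functions on $\mathbb D$. For $g$ holomorphic matrix-valued and $\varphi$ a holomorphic self-map of $\mathbb D$, $(M_gC_\varphi f)(z)=g(z)f(\varphi(z))$. *)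

theory Defs
  imports "HOL-Complex_Analysis.Complex_Analysis" "HOL-Library.Function_Algebras"
begin

abbreviation unit_disc :: "complex set" ("\<bbbD>")
  where "\<bbbD> \<equiv> ball 0 1"

definition Mob :: "(complex \<Rightarrow> complex) set"
  where "Mob = {\<phi>. bij_betw \<phi> \<bbbD> \<bbbD> \<and> \<phi> holomorphic_on \<bbbD> \<and> inv_into \<bbbD> \<phi> holomorphic_on \<bbbD>}"


section \<open>Hilbert spaces of vector-valued functions\<close>

text \<open>A function \<open>f : \<bbbD> \<rightarrow> \<complex>\<^sup>n\<close> is represented by the total function that agrees with \<open>f\<close> on the disc
  and vanishes off it, so that equality of functions is equality on the disc. Addition and subtraction
  of functions are the pointwise operations.\<close>

type_synonym 'n vfun = "complex \<Rightarrow> complex ^ 'n"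

definition fscale :: "complex \<Rightarrow> 'n::finite vfun \<Rightarrow> 'n vfun"
  where "fscale c f = (\<lambda>z. c *s f z)"

text \<open>Inner products are linear in the first and conjugate-linear in the second argument.\<close>

definition cdot :: "complex ^ 'n::finite \<Rightarrow> complex ^ 'n \<Rightarrow> complex"
  where "cdot x y = (\<Sum>i\<in>UNIV. x $ i * cnj (y $ i))"

definition hnorm :: "('n::finite vfun \<Rightarrow> 'n vfun \<Rightarrow> complex) \<Rightarrow> 'n vfun \<Rightarrow> real"
  where "hnorm ip f = sqrt (Re (ip f f))"

locale hilbert_function_space =
  fixes H :: "'n::finite vfun set"
    and ip :: "'n vfun \<Rightarrow> 'n vfun \<Rightarrow> complex"
  assumes holomorphic: "f \<in> H \<Longrightarrow> (\<lambda>z. f z $ i) holomorphic_on \<bbbD>"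
    and zero_off_disc: "f \<in> H \<Longrightarrow> z \<notin> \<bbbD> \<Longrightarrow> f z = 0"
    and zero_mem: "0 \<in> H"
    and add_mem: "f \<in> H \<Longrightarrow> g \<in> H \<Longrightarrow> f + g \<in> H"
    and scale_mem: "f \<in> H \<Longrightarrow> fscale c f \<in> H"
    and ip_add: "f \<in> H \<Longrightarrow> g \<in> H \<Longrightarrow> h \<in> H \<Longrightarrow> ip (f + g) h = ip f h + ip g h"
    and ip_scale: "f \<in> H \<Longrightarrow> g \<in> H \<Longrightarrow> ip (fscale c f) g = c * ip f g"
    and ip_commute: "f \<in> H \<Longrightarrow> g \<in> H \<Longrightarrow> ip g f = cnj (ip f g)"
    and ip_nonneg: "f \<in> H \<Longrightarrow> 0 \<le> Re (ip f f)"
    and ip_definite: "f \<in> H \<Longrightarrow> ip f f = 0 \<Longrightarrow> f = 0"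
    and complete: "(\<And>k. s k \<in> H) \<Longrightarrow> (\<And>e. e > 0 \<Longrightarrow> \<exists>N. \<forall>k\<ge>N. \<forall>l\<ge>N. hnorm ip (s k - s l) < e)
      \<Longrightarrow> \<exists>f\<in>H. (\<lambda>k. hnorm ip (s k - f)) \<longlonglongrightarrow> 0"


section \<open>Positive definite kernels and their reproducing kernel Hilbert spaces\<close>

text \<open>The distinct points \<open>w\<^sub>1, \<dots>, w\<^sub>l\<close> form a finite set \<open>W\<close>, and \<open>W\<close> itself indexes the rows and
  columns of the block matrix. Only the values of \<open>K\<close> on \<open>\<bbbD> \<times> \<bbbD>\<close> matter.\<close>

definition block_nonneg_definite :: "complex set \<Rightarrow> (complex \<Rightarrow> complex \<Rightarrow> complex ^ 'n::finite ^ 'n) \<Rightarrow> bool"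
  where "block_nonneg_definite W B \<longleftrightarrow>
    (\<forall>\<eta> :: complex \<Rightarrow> complex ^ 'n. \<exists>q\<ge>0. (\<Sum>u\<in>W. \<Sum>v\<in>W. cdot (B u v *v \<eta> v) (\<eta> u)) = complex_of_real q)"

definition block_invertible :: "complex set \<Rightarrow> (complex \<Rightarrow> complex \<Rightarrow> complex ^ 'n::finite ^ 'n) \<Rightarrow> bool"
  where "block_invertible W B \<longleftrightarrow>
    (\<exists>C. \<forall>u\<in>W. \<forall>v\<in>W.
       (\<Sum>w\<in>W. B u w ** C w v) = (if u = v then mat 1 else 0) \<and>
       (\<Sum>w\<in>W. C u w ** B w v) = (if u = v then mat 1 else 0))"

definition positive_definite_kernel :: "(complex \<Rightarrow> complex \<Rightarrow> complex ^ 'n::finite ^ 'n) \<Rightarrow> bool"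
  where "positive_definite_kernel K \<longleftrightarrow>
    (\<forall>w\<in>\<bbbD>. \<forall>i j. (\<lambda>z. K z w $ i $ j) holomorphic_on \<bbbD>) \<and>
    (\<forall>z\<in>\<bbbD>. \<forall>i j. (\<lambda>w. cnj (K z w $ i $ j)) holomorphic_on \<bbbD>) \<and>
    (\<forall>W. finite W \<and> W \<subseteq> \<bbbD> \<longrightarrow> block_nonneg_definite W K \<and> block_invertible W K)"

text \<open>\<open>kernel_section K w \<eta>\<close> is \<open>K(\<cdot>, w)\<eta>\<close>.\<close>

definition kernel_section :: "(complex \<Rightarrow> complex \<Rightarrow> complex ^ 'n::finite ^ 'n) \<Rightarrow> complex \<Rightarrow> complex ^ 'n \<Rightarrow> 'n vfun"
  where "kernel_section K w \<eta> = (\<lambda>z. if z \<in> \<bbbD> then K z w *v \<eta> else 0)"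

text \<open>The space \<open>(\<H>, K)\<close>; by Moore's theorem, \<open>K\<close> determines \<open>H\<close> and the restriction of \<open>ip\<close> to \<open>H\<close>.\<close>

locale rkhs = hilbert_function_space H ip
  for K :: "complex \<Rightarrow> complex \<Rightarrow> complex ^ 'n ^ 'n" and H :: "'n::finite vfun set" and ip +
  assumes kernel_section_mem: "w \<in> \<bbbD> \<Longrightarrow> kernel_section K w \<eta> \<in> H"
    and reproducing: "f \<in> H \<Longrightarrow> w \<in> \<bbbD> \<Longrightarrow> ip f (kernel_section K w \<eta>) = cdot (f w) \<eta>"


section \<open>Bounded operators\<close>

text \<open>An operator on \<open>H\<close> is a total map on functions of which only the restriction to \<open>H\<close> matters.\<close>

type_synonym 'n oper = "'n vfun \<Rightarrow> 'n vfun"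

definition bounded_op :: "'n::finite vfun set \<Rightarrow> ('n vfun \<Rightarrow> 'n vfun \<Rightarrow> complex) \<Rightarrow> 'n oper \<Rightarrow> bool"
  where "bounded_op H ip T \<longleftrightarrow>
    T ` H \<subseteq> H \<and>
    (\<forall>f\<in>H. \<forall>g\<in>H. T (f + g) = T f + T g) \<and>
    (\<forall>c. \<forall>f\<in>H. T (fscale c f) = fscale c (T f)) \<and>
    (\<exists>C. \<forall>f\<in>H. hnorm ip (T f) \<le> C * hnorm ip f)"

definition inverse_ops :: "'n::finite vfun set \<Rightarrow> ('n vfun \<Rightarrow> 'n vfun \<Rightarrow> complex) \<Rightarrow> 'n oper \<Rightarrow> 'n oper \<Rightarrow> bool"
  where "inverse_ops H ip S T \<longleftrightarrow>
    bounded_op H ip S \<and> bounded_op H ip T \<and> (\<forall>f\<in>H. S (T f) = f \<and> T (S f) = f)"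

definition bounded_invertible_op :: "'n::finite vfun set \<Rightarrow> ('n vfun \<Rightarrow> 'n vfun \<Rightarrow> complex) \<Rightarrow> 'n oper \<Rightarrow> bool"
  where "bounded_invertible_op H ip T \<longleftrightarrow> (\<exists>S. inverse_ops H ip S T)"

definition similar_ops :: "'n::finite vfun set \<Rightarrow> ('n vfun \<Rightarrow> 'n vfun \<Rightarrow> complex) \<Rightarrow> 'n oper \<Rightarrow> 'n oper \<Rightarrow> bool"
  where "similar_ops H ip A T \<longleftrightarrow>
    (\<exists>L L'. inverse_ops H ip L' L \<and> (\<forall>f\<in>H. A f = L (T (L' f))))"

definition op_spectrum :: "'n::finite vfun set \<Rightarrow> ('n vfun \<Rightarrow> 'n vfun \<Rightarrow> complex) \<Rightarrow> 'n oper \<Rightarrow> complex set"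
  where "op_spectrum H ip T = {\<mu>. \<not> bounded_invertible_op H ip (\<lambda>f. fscale \<mu> f - T f)}"

definition resolvent :: "'n::finite vfun set \<Rightarrow> 'n oper \<Rightarrow> complex \<Rightarrow> 'n oper"
  where "resolvent H T \<mu> = inv_into H (\<lambda>f. fscale \<mu> f - T f)"

definition adj :: "'n::finite vfun set \<Rightarrow> ('n vfun \<Rightarrow> 'n vfun \<Rightarrow> complex) \<Rightarrow> 'n oper \<Rightarrow> 'n oper"
  where "adj H ip T g = (THE h. h \<in> H \<and> (\<forall>f\<in>H. ip (T f) g = ip f h))"

text \<open>\<open>disc_calculus H ip T \<phi> A\<close> says that \<open>A = \<phi>(T)\<close> for an operator \<open>T\<close> with spectrum in the closed
  unit disc and a function \<open>\<phi>\<close> on the open disc with a holomorphic extension \<open>F\<close> to a neighbourhood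
  of the closed disc. It is the Riesz-Dunford formula
    \<open>\<phi>(T) = (1 / 2\<pi>\<i>) \<integral> F(\<mu>) (\<mu> - T)\<inverse> d\<mu>\<close>
  over a circle around the closed disc, the operator-valued integral being taken in the weak sense.
  By Cauchy's theorem and the identity theorem, \<open>A\<close> on \<open>H\<close> does not depend on \<open>F\<close>, \<open>R\<close> and \<open>r\<close>.\<close>

definition disc_calculus ::
    "'n::finite vfun set \<Rightarrow> ('n vfun \<Rightarrow> 'n vfun \<Rightarrow> complex) \<Rightarrow> 'n oper \<Rightarrow> (complex \<Rightarrow> complex) \<Rightarrow> 'n oper \<Rightarrow> bool"
  where "disc_calculus H ip T \<phi> A \<longleftrightarrow>
    bounded_op H ip A \<and>
    (\<exists>F r R. 1 < r \<and> r < R \<and> F holomorphic_on ball 0 R \<and> (\<forall>z\<in>\<bbbD>. F z = \<phi> z) \<and>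
       (\<forall>f\<in>H. \<forall>h\<in>H.
          ((\<lambda>\<mu>. F \<mu> * ip (resolvent H T \<mu> f) h)
             has_contour_integral (2 * of_real pi * \<i> * ip (A f) h)) (circlepath 0 r)))"

definition weakly_homogeneous :: "'n::finite vfun set \<Rightarrow> ('n vfun \<Rightarrow> 'n vfun \<Rightarrow> complex) \<Rightarrow> 'n oper \<Rightarrow> bool"
  where "weakly_homogeneous H ip T \<longleftrightarrow>
    bounded_op H ip T \<and> op_spectrum H ip T \<subseteq> cball 0 1 \<and>
    (\<forall>\<phi>\<in>Mob. \<exists>A. disc_calculus H ip T \<phi> A \<and> similar_ops H ip A T)"


section \<open>Multiplication and weighted composition operators\<close>

definition mult_z :: "'n::finite oper"
  where "mult_z f = (\<lambda>z. z *s f z)"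

definition holomorphic_GL :: "(complex \<Rightarrow> complex ^ 'n::finite ^ 'n) \<Rightarrow> bool"
  where "holomorphic_GL g \<longleftrightarrow>
    (\<forall>i j. (\<lambda>z. g z $ i $ j) holomorphic_on \<bbbD>) \<and> (\<forall>z\<in>\<bbbD>. invertible (g z))"

definition weighted_comp :: "(complex \<Rightarrow> complex ^ 'n::finite ^ 'n) \<Rightarrow> (complex \<Rightarrow> complex) \<Rightarrow> 'n oper"
  where "weighted_comp g \<psi> f = (\<lambda>z. if z \<in> \<bbbD> then g z *v f (\<psi> z) else 0)"

definition sharp_kernel ::
    "(complex \<Rightarrow> complex \<Rightarrow> complex ^ 'n::finite ^ 'n) \<Rightarrow> 'n vfun set \<Rightarrow> ('n vfun \<Rightarrow> 'n vfun \<Rightarrow> complex) \<Rightarrow> bool"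
  where "sharp_kernel K H ip \<longleftrightarrow>
    bounded_op H ip mult_z \<and>
    (\<forall>w\<in>\<bbbD>. {f \<in> H. adj H ip mult_z f - fscale (cnj w) f = 0} = range (kernel_section K w))"

end

theory Submission imports Defs begin

text \<open>
  Write \<open>M\<^sub>\<phi>\<close> for multiplication by a scalar function \<open>\<phi>\<close>. A weighted composition operator \<open>W f = g (f \<circ> \<phi>)\<close>
  satisfies \<open>W M\<^sub>z = M\<^sub>\<phi> W\<close>. Invertible weighted compositions for all automorphisms therefore make
  every \<open>M\<^sub>\<phi>\<close> bounded and similar to \<open>M\<^sub>z\<close>. Two things remain for weak homogeneity. The spectrum of
  \<open>M\<^sub>z\<close> lies in the closed disc because \<open>1 / (\<mu> - z)\<close>, for \<open>\<bar>\<mu>\<bar> > 1\<close>, is a linear combination of 1 and a Moebius map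
  (\<open>spectrum_mult_z\<close>). And \<open>M\<^sub>\<phi>\<close> must be the value \<open>\<phi>(M\<^sub>z)\<close> of the Riesz-Dunford integral. Since \<open>\<phi>\<close> is a
  Moebius map (\<open>Mob_explicit\<close>), the resolvent equation reduces this integral to that of the
  resolvent alone (\<open>disc_calculus_Moebius\<close>). The latter is evaluated by Cauchy's formula at the point at
  infinity, once the resolvent is known to be weakly holomorphic there (\<open>resolvent_integral\<close>).

  Conversely, let \<open>\<phi>(M\<^sub>z) = L M\<^sub>z L\<inverse>\<close>. Pairing the Riesz-Dunford integral with kernel functions
  shows \<open>\<phi>(M\<^sub>z) = M\<^sub>\<phi>\<close> (\<open>disc_calculus_mult_z\<close>), so \<open>L M\<^sub>z = M\<^sub>\<phi> L\<close>. The adjoint of \<open>L\<close> then maps \<open>K(\<cdot>, w)\<eta>\<close> into the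
  eigenspace of \<open>M\<^sub>z\<^sup>*\<close> for \<open>cnj (\<phi> w)\<close>, which for a sharp kernel consists of the functions
  \<open>K(\<cdot>, \<phi> w)\<xi>\<close>. So \<open>(L f)(w)\<close> depends only on \<open>f(\<phi> w)\<close>, and linearly: \<open>(L f)(w) = g(w) f(\<phi> w)\<close>
  (\<open>intertwiner_evaluation\<close>). The matrix \<open>g(w)\<close> is invertible since \<open>L\<close> and all point evaluations are
  onto, and it is holomorphic by Cramer's rule (\<open>intertwiner_is_weighted_comp\<close>). The vector in the range of the
  adjoint is provided by the Riesz representation theorem, which is proved for the Hilbert function
  spaces at hand.\<close>

section \<open>Geometry of the Hilbert space\<close>

context hilbert_function_space
begin

lemma diff_conv_fscale: "f - g = f + fscale (- 1) g"
  by (auto simp: fscale_def fun_eq_iff vec_eq_iff)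

lemma diff_mem: "f \<in> H \<Longrightarrow> g \<in> H \<Longrightarrow> f - g \<in> H"
  by (simp add: diff_conv_fscale add_mem scale_mem)

lemma ip_diff: "f \<in> H \<Longrightarrow> g \<in> H \<Longrightarrow> h \<in> H \<Longrightarrow> ip (f - g) h = ip f h - ip g h"
  by (simp add: diff_conv_fscale ip_add ip_scale scale_mem)

lemma ip_add_right: "f \<in> H \<Longrightarrow> g \<in> H \<Longrightarrow> h \<in> H \<Longrightarrow> ip f (g + h) = ip f g + ip f h"
  by (metis add_mem complex_cnj_add ip_add ip_commute)

lemma ip_scale_right: "f \<in> H \<Longrightarrow> g \<in> H \<Longrightarrow> ip f (fscale c g) = cnj c * ip f g"
  by (metis complex_cnj_mult ip_commute ip_scale scale_mem)

lemma ip_diff_right: "f \<in> H \<Longrightarrow> g \<in> H \<Longrightarrow> h \<in> H \<Longrightarrow> ip f (g - h) = ip f g - ip f h"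
  by (simp add: diff_conv_fscale ip_add_right ip_scale_right scale_mem)

lemma hnorm_nonneg: "f \<in> H \<Longrightarrow> 0 \<le> hnorm ip f"
  by (simp add: hnorm_def ip_nonneg)

lemma hnorm_square: "f \<in> H \<Longrightarrow> (hnorm ip f)\<^sup>2 = Re (ip f f)"
  by (simp add: hnorm_def ip_nonneg)

lemma ip_self: "f \<in> H \<Longrightarrow> ip f f = of_real ((hnorm ip f)\<^sup>2)"
  using ip_commute[of f f] by (simp add: hnorm_square complex_eq_iff)

lemma hnorm_eq_0: "f \<in> H \<Longrightarrow> hnorm ip f = 0 \<Longrightarrow> f = 0"
  by (simp add: ip_definite ip_self)

lemma hnorm_scale:
  assumes f: "f \<in> H"
  shows "hnorm ip (fscale c f) = cmod c * hnorm ip f"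
proof (rule power2_eq_imp_eq)
  have "ip (fscale c f) (fscale c f) = (c * cnj c) * ip f f"
    by (simp add: f ip_scale ip_scale_right scale_mem)
  also have "\<dots> = of_real ((cmod c)\<^sup>2 * (hnorm ip f)\<^sup>2)"
    by (simp only: ip_self[OF f] complex_norm_square[symmetric] of_real_mult)
  finally show "(hnorm ip (fscale c f))\<^sup>2 = (cmod c * hnorm ip f)\<^sup>2"
    by (simp add: hnorm_square scale_mem f power_mult_distrib)
qed (simp_all add: f hnorm_nonneg scale_mem)

lemma hnorm_add_square:
  assumes "f \<in> H" "g \<in> H"
  shows "(hnorm ip (f + g))\<^sup>2 = (hnorm ip f)\<^sup>2 + 2 * Re (ip f g) + (hnorm ip g)\<^sup>2"
  using assms ip_commute[of f g] by (simp add: hnorm_square add_mem ip_add ip_add_right)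

lemma hnorm_diff_square:
  assumes "f \<in> H" "g \<in> H"
  shows "(hnorm ip (f - g))\<^sup>2 = (hnorm ip f)\<^sup>2 - 2 * Re (ip f g) + (hnorm ip g)\<^sup>2"
  using assms ip_commute[of f g] by (simp add: hnorm_square diff_mem ip_diff ip_diff_right)

lemma Cauchy_Schwarz:
  assumes f: "f \<in> H" and g: "g \<in> H"
  shows "cmod (ip f g) \<le> hnorm ip f * hnorm ip g"
proof (cases "hnorm ip g = 0")
  case True
  then have "g = fscale 0 g" using hnorm_eq_0[OF g] by (auto simp: fscale_def fun_eq_iff)
  then have "ip f g = 0" using ip_scale_right[OF f g, of 0] by simp
  then show ?thesis using True by simp
next
  case False
  define s where "s = (hnorm ip g)\<^sup>2"
  have s: "s > 0" using False by (simp add: s_def)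
  have cc: "cnj (ip f g) * ip f g = of_real ((cmod (ip f g))\<^sup>2)"
    using complex_norm_square[of "ip f g"] by (simp add: mult.commute)
  have "0 \<le> (hnorm ip (fscale s f - fscale (ip f g) g))\<^sup>2" by simp
  also have "\<dots> = s\<^sup>2 * (hnorm ip f)\<^sup>2 - 2 * Re (s * (cnj (ip f g) * ip f g)) + (cmod (ip f g))\<^sup>2 * s"
    using f g s by (subst hnorm_diff_square)
      (auto simp: scale_mem hnorm_scale ip_scale ip_scale_right power_mult_distrib s_def norm_power
        algebra_simps)
  also have "\<dots> = s * (s * (hnorm ip f)\<^sup>2 - (cmod (ip f g))\<^sup>2)"
    unfolding cc by (simp add: algebra_simps power2_eq_square)
  finally have "0 \<le> s * (hnorm ip f)\<^sup>2 - (cmod (ip f g))\<^sup>2"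
    using s by (metis zero_le_mult_iff not_less)
  then have "(cmod (ip f g))\<^sup>2 \<le> s * (hnorm ip f)\<^sup>2"
    by simp
  then have "(cmod (ip f g))\<^sup>2 \<le> (hnorm ip f * hnorm ip g)\<^sup>2"
    by (simp add: s_def power_mult_distrib mult.commute)
  then show ?thesis
    by (rule power2_le_imp_le) (simp add: f g hnorm_nonneg)
qed

lemma hnorm_triangle:
  assumes "f \<in> H" "g \<in> H"
  shows "hnorm ip (f + g) \<le> hnorm ip f + hnorm ip g"
proof (rule power2_le_imp_le)
  have "Re (ip f g) \<le> hnorm ip f * hnorm ip g"
    using Cauchy_Schwarz[OF assms] complex_Re_le_cmod order_trans by blast
  then show "(hnorm ip (f + g))\<^sup>2 \<le> (hnorm ip f + hnorm ip g)\<^sup>2"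
    by (simp add: hnorm_add_square assms power2_sum)
qed (simp add: assms hnorm_nonneg)

text \<open>A bounded functional \<open>\<Lambda>\<close> is represented by the minimiser of
  \<open>J f = \<parallel>f\<parallel>\<^sup>2 - 2 Re (\<Lambda> f)\<close>: if \<open>\<Lambda> = \<langle>\<cdot>, h\<rangle>\<close>, then \<open>J f = \<parallel>f - h\<parallel>\<^sup>2 - \<parallel>h\<parallel>\<^sup>2\<close>. The parallelogram law makes
  every minimising sequence Cauchy, and the vanishing of the first variation at its limit is
  the representation formula.\<close>

lemma Riesz_representation:
  assumes add: "\<And>f g. f \<in> H \<Longrightarrow> g \<in> H \<Longrightarrow> \<Lambda> (f + g) = \<Lambda> f + \<Lambda> g"
    and scale: "\<And>c f. f \<in> H \<Longrightarrow> \<Lambda> (fscale c f) = c * \<Lambda> f"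
    and bound: "\<And>f. f \<in> H \<Longrightarrow> cmod (\<Lambda> f) \<le> C * hnorm ip f"
  shows "\<exists>h\<in>H. \<forall>f\<in>H. \<Lambda> f = ip f h"
proof -
  define J where "J f = (hnorm ip f)\<^sup>2 - 2 * Re (\<Lambda> f)" for f
  have lower: "J f \<ge> - C\<^sup>2" if "f \<in> H" for f
  proof -
    have "Re (\<Lambda> f) \<le> C * hnorm ip f"
      using bound[OF that] complex_Re_le_cmod order_trans by blast
    moreover have "0 \<le> (hnorm ip f - C)\<^sup>2" by simp
    ultimately show ?thesis
      by (simp add: J_def power2_diff mult.commute)
  qed
  define m where "m = Inf (J ` H)"
  have bdd: "bdd_below (J ` H)" using lower by (auto intro!: bdd_belowI)
  have m_le: "m \<le> J f" if "f \<in> H" for f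
    unfolding m_def using bdd that by (auto intro: cInf_lower)
  have "\<exists>f\<in>H. J f < m + 1 / real (Suc k)" for k
    using cInf_lessD[of "J ` H" "m + 1 / real (Suc k)"] zero_mem by (auto simp: m_def)
  then obtain s where sH: "\<And>k. s k \<in> H" and sJ: "\<And>k. J (s k) < m + 1 / real (Suc k)"
    by metis
  have close: "(hnorm ip (s k - s l))\<^sup>2 \<le> 2 / real (Suc k) + 2 / real (Suc l)" for k l
  proof -
    define p where "p = fscale (1/2) (s k + s l)"
    have p: "p \<in> H" by (simp add: p_def sH add_mem scale_mem)
    have "(hnorm ip (s k - s l))\<^sup>2 = 2 * J (s k) + 2 * J (s l) - 4 * J p"
      by (simp add: J_def p_def hnorm_diff_square hnorm_add_square hnorm_scale sH add_mem add scale
          power_mult_distrib power_divide norm_divide field_simps)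
    moreover have "m \<le> J p" using m_le[OF p] .
    ultimately show ?thesis using sJ[of k] sJ[of l] by simp
  qed
  have "\<exists>N. \<forall>k\<ge>N. \<forall>l\<ge>N. hnorm ip (s k - s l) < e" if "e > 0" for e
  proof -
    have "(\<lambda>n. 4 * inverse (real (Suc n))) \<longlonglongrightarrow> 4 * 0"
      by (intro tendsto_intros LIMSEQ_inverse_real_of_nat)
    then have "eventually (\<lambda>n. 4 * inverse (real (Suc n)) < e\<^sup>2) sequentially"
      by (rule order_tendstoD(2)) (use that in simp)
    then obtain N where N: "4 / real (Suc N) < e\<^sup>2"
      by (auto simp: eventually_sequentially divide_inverse)
    have "hnorm ip (s k - s l) < e" if "k \<ge> N" "l \<ge> N" for k l
    proof (rule power2_less_imp_less)
      have "2 / real (Suc k) \<le> 2 / real (Suc N)" "2 / real (Suc l) \<le> 2 / real (Suc N)"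
        using that by (simp_all add: frac_le)
      then show "(hnorm ip (s k - s l))\<^sup>2 < e\<^sup>2" using close[of k l] N by simp
    qed (use \<open>e > 0\<close> in simp)
    then show ?thesis by blast
  qed
  then obtain h where h: "h \<in> H" and lim: "(\<lambda>k. hnorm ip (s k - h)) \<longlonglongrightarrow> 0"
    using complete[of s] sH by blast
  have ip_lim: "(\<lambda>k. ip (s k) f) \<longlonglongrightarrow> ip h f" if f: "f \<in> H" for f
  proof (rule LIM_zero_cancel, rule Lim_null_comparison)
    show "\<forall>\<^sub>F k in sequentially. norm (ip (s k) f - ip h f) \<le> hnorm ip (s k - h) * hnorm ip f"
      using Cauchy_Schwarz[OF diff_mem[OF sH h] f] by (simp add: ip_diff sH h f)
    show "(\<lambda>k. hnorm ip (s k - h) * hnorm ip f) \<longlonglongrightarrow> 0"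
      using tendsto_mult_right[OF lim, of "hnorm ip f"] by simp
  qed
  have variation: "0 \<le> 2 * t * (Re (ip h f) - Re (\<Lambda> f)) + t\<^sup>2 * (hnorm ip f)\<^sup>2"
    if f: "f \<in> H" for f and t :: real
  proof (rule tendsto_lowerbound)
    have "((\<lambda>k. 2 * t * (Re (ip (s k) f) - Re (\<Lambda> f)) + t\<^sup>2 * (hnorm ip f)\<^sup>2 + inverse (real (Suc k)))
        \<longlonglongrightarrow> 2 * t * (Re (ip h f) - Re (\<Lambda> f)) + t\<^sup>2 * (hnorm ip f)\<^sup>2 + 0)"
      by (intro tendsto_intros ip_lim f LIMSEQ_inverse_real_of_nat)
    then show "((\<lambda>k. 2 * t * (Re (ip (s k) f) - Re (\<Lambda> f)) + t\<^sup>2 * (hnorm ip f)\<^sup>2 + inverse (real (Suc k)))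
        \<longlonglongrightarrow> 2 * t * (Re (ip h f) - Re (\<Lambda> f)) + t\<^sup>2 * (hnorm ip f)\<^sup>2)" by simp
    have "0 \<le> 2 * t * (Re (ip (s k) f) - Re (\<Lambda> f)) + t\<^sup>2 * (hnorm ip f)\<^sup>2 + inverse (real (Suc k))" for k
    proof -
      have "m \<le> J (s k + fscale t f)" by (intro m_le add_mem scale_mem sH f)
      also have "\<dots> = J (s k) + 2 * t * (Re (ip (s k) f) - Re (\<Lambda> f)) + t\<^sup>2 * (hnorm ip f)\<^sup>2"
        by (simp add: J_def hnorm_add_square hnorm_scale ip_scale_right add scale sH f scale_mem
            power_mult_distrib algebra_simps)
      finally show ?thesis using sJ[of k] by (simp add: divide_inverse)
    qed
    then show "\<forall>\<^sub>F k in sequentially.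
        0 \<le> 2 * t * (Re (ip (s k) f) - Re (\<Lambda> f)) + t\<^sup>2 * (hnorm ip f)\<^sup>2 + inverse (real (Suc k))"
      by simp
  qed simp
  have Re_eq: "Re (\<Lambda> f) = Re (ip f h)" if f: "f \<in> H" for f
  proof -
    define d where "d = Re (ip h f) - Re (\<Lambda> f)"
    define n where "n = (hnorm ip f)\<^sup>2 + 1"
    have n: "n > 0" by (simp add: n_def add_nonneg_pos)
    (* the value of t at which the quadratic lower bound, with n in place of the squared norm,
       is smallest *)
    have "0 \<le> 2 * (- d / n) * d + (- d / n)\<^sup>2 * (hnorm ip f)\<^sup>2"
      using variation[OF f, of "- d / n"] by (simp add: d_def)
    also have "\<dots> \<le> 2 * (- d / n) * d + (- d / n)\<^sup>2 * n"
      by (intro add_left_mono mult_left_mono) (auto simp: n_def)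
    also have "\<dots> = - (d\<^sup>2 / n)" using n by (simp add: power2_eq_square field_simps)
    finally have "d = 0" using n by (simp add: divide_le_0_iff)
    then show ?thesis using ip_commute[OF f h] by (simp add: d_def)
  qed
  have "\<Lambda> f = ip f h" if f: "f \<in> H" for f
  proof (rule complex_eqI)
    show "Im (\<Lambda> f) = Im (ip f h)"
      using Re_eq[OF scale_mem[OF f, of "- \<i>"]] by (simp add: scale ip_scale f h)
  qed (rule Re_eq[OF f])
  then show ?thesis using h by blast
qed

end


section \<open>Bounded operators and their resolvents\<close>

lemma fscale_apply [simp]: "fscale c f z = c *s f z"
  by (simp add: fscale_def)

lemma fscale_fscale [simp]: "fscale a (fscale b f) = fscale (a * b) f"
  by (simp add: fun_eq_iff)

lemma fscale_1 [simp]: "fscale 1 f = f"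
  by (simp add: fun_eq_iff)

context hilbert_function_space
begin

lemma bounded_op_mem: "bounded_op H ip T \<Longrightarrow> f \<in> H \<Longrightarrow> T f \<in> H"
  by (auto simp: bounded_op_def)

lemma bounded_op_plus: "bounded_op H ip T \<Longrightarrow> f \<in> H \<Longrightarrow> g \<in> H \<Longrightarrow> T (f + g) = T f + T g"
  by (auto simp: bounded_op_def)

lemma bounded_op_fscale: "bounded_op H ip T \<Longrightarrow> f \<in> H \<Longrightarrow> T (fscale c f) = fscale c (T f)"
  by (auto simp: bounded_op_def)

lemma bounded_op_diff: "bounded_op H ip T \<Longrightarrow> f \<in> H \<Longrightarrow> g \<in> H \<Longrightarrow> T (f - g) = T f - T g"
  unfolding diff_conv_fscale[of f g] diff_conv_fscale[of "T f" "T g"]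
  by (simp only: bounded_op_plus bounded_op_fscale scale_mem)

lemma bounded_op_bound:
  assumes "bounded_op H ip T"
  obtains C where "0 \<le> C" "\<And>f. f \<in> H \<Longrightarrow> hnorm ip (T f) \<le> C * hnorm ip f"
proof -
  obtain C where C: "\<And>f. f \<in> H \<Longrightarrow> hnorm ip (T f) \<le> C * hnorm ip f"
    using assms unfolding bounded_op_def by blast
  have "hnorm ip (T f) \<le> max C 0 * hnorm ip f" if "f \<in> H" for f
    using C[OF that] mult_right_mono[OF _ hnorm_nonneg[OF that], of C "max C 0"] by simp
  then show ?thesis using that[of "max C 0"] by simp
qed

lemma bounded_op_cong:
  assumes "bounded_op H ip T" "\<And>f. f \<in> H \<Longrightarrow> S f = T f"
  shows "bounded_op H ip S"
  using assms by (auto simp: bounded_op_def add_mem scale_mem image_subset_iff)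

lemma bounded_op_lincomb:
  assumes T: "bounded_op H ip T"
  shows "bounded_op H ip (\<lambda>f. fscale a f + fscale b (T f))"
proof -
  obtain C where C: "\<And>f. f \<in> H \<Longrightarrow> hnorm ip (T f) \<le> C * hnorm ip f"
    using bounded_op_bound[OF T] by blast
  have "hnorm ip (fscale a f + fscale b (T f)) \<le> (cmod a + cmod b * C) * hnorm ip f" if f: "f \<in> H" for f
  proof -
    have "hnorm ip (fscale a f + fscale b (T f)) \<le> cmod a * hnorm ip f + cmod b * hnorm ip (T f)"
      using hnorm_triangle[of "fscale a f" "fscale b (T f)"]
      by (simp add: hnorm_scale scale_mem bounded_op_mem[OF T] f)
    also have "\<dots> \<le> cmod a * hnorm ip f + cmod b * (C * hnorm ip f)"
      by (intro add_left_mono mult_left_mono C f) simp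
    finally show ?thesis by (simp add: algebra_simps)
  qed
  moreover have "fscale a (f + g) + fscale b (T (f + g)) = fscale a f + fscale b (T f) + (fscale a g + fscale b (T g))"
    if "f \<in> H" "g \<in> H" for f g
    using that by (simp add: bounded_op_plus[OF T] fun_eq_iff vec_eq_iff algebra_simps)
  moreover have "fscale a (fscale c f) + fscale b (T (fscale c f)) = fscale c (fscale a f + fscale b (T f))"
    if "f \<in> H" for f c
    using that by (simp add: bounded_op_fscale[OF T] fun_eq_iff vec_eq_iff algebra_simps)
  ultimately show ?thesis
    unfolding bounded_op_def by (auto intro!: add_mem scale_mem bounded_op_mem[OF T])
qed

lemma bounded_op_comp:
  assumes S: "bounded_op H ip S" and T: "bounded_op H ip T"
  shows "bounded_op H ip (\<lambda>f. S (T f))"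
proof -
  obtain C where "0 \<le> C" and C: "\<And>f. f \<in> H \<Longrightarrow> hnorm ip (S f) \<le> C * hnorm ip f"
    using bounded_op_bound[OF S] by blast
  obtain D where D: "\<And>f. f \<in> H \<Longrightarrow> hnorm ip (T f) \<le> D * hnorm ip f"
    using bounded_op_bound[OF T] by blast
  have "hnorm ip (S (T f)) \<le> (C * D) * hnorm ip f" if f: "f \<in> H" for f
    using C[OF bounded_op_mem[OF T f]] mult_left_mono[OF D[OF f] \<open>0 \<le> C\<close>] by simp
  then show ?thesis
    unfolding bounded_op_def
    by (auto simp: bounded_op_plus[OF S] bounded_op_plus[OF T] bounded_op_fscale[OF S]
        bounded_op_fscale[OF T] bounded_op_mem[OF S] bounded_op_mem[OF T])
qed

end

text \<open>The bounded operators with spectrum in the closed disc: their resolvents exist on every circle of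
  radius greater than 1, as the functional calculus requires.\<close>

locale disc_operator = hilbert_function_space H ip
  for H :: "'n::finite vfun set" and ip +
  fixes T :: "'n oper"
  assumes bounded: "bounded_op H ip T"
    and spectrum: "op_spectrum H ip T \<subseteq> cball 0 1"
begin

lemma inverse_of_shift:
  assumes "1 < cmod \<mu>"
  obtains S where "bounded_op H ip S"
    "\<And>f. f \<in> H \<Longrightarrow> fscale \<mu> (S f) - T (S f) = f" "\<And>f. f \<in> H \<Longrightarrow> S (fscale \<mu> f - T f) = f"
proof -
  have "\<mu> \<notin> op_spectrum H ip T"
    using assms spectrum by auto
  then show ?thesis
    using that by (auto simp: op_spectrum_def bounded_invertible_op_def inverse_ops_def)
qed

lemma resolvent_eqI:
  assumes "1 < cmod \<mu>" "u \<in> H" "fscale \<mu> u - T u = f"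
  shows "resolvent H T \<mu> f = u"
proof -
  obtain S where S: "\<And>f. f \<in> H \<Longrightarrow> S (fscale \<mu> f - T f) = f"
    using inverse_of_shift[OF assms(1)] by metis
  have "inj_on (\<lambda>f. fscale \<mu> f - T f) H"
    by (rule inj_on_inverseI[where g = S]) (rule S)
  then show ?thesis
    unfolding resolvent_def by (rule inv_into_f_eq) (use assms in auto)
qed

lemma bounded_resolvent:
  assumes "1 < cmod \<mu>"
  shows "bounded_op H ip (resolvent H T \<mu>)"
proof -
  obtain S where S: "bounded_op H ip S" "\<And>f. f \<in> H \<Longrightarrow> fscale \<mu> (S f) - T (S f) = f"
    using inverse_of_shift[OF assms] by metis
  show ?thesis
    by (rule bounded_op_cong[OF S(1)]) (auto intro!: resolvent_eqI assms bounded_op_mem[OF S(1)] S(2))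
qed

lemma resolvent_mem: "1 < cmod \<mu> \<Longrightarrow> f \<in> H \<Longrightarrow> resolvent H T \<mu> f \<in> H"
  by (rule bounded_op_mem[OF bounded_resolvent])

lemma resolvent_eq:
  assumes "1 < cmod \<mu>" "f \<in> H"
  shows "fscale \<mu> (resolvent H T \<mu> f) - T (resolvent H T \<mu> f) = f"
proof -
  obtain S where S: "bounded_op H ip S" "\<And>f. f \<in> H \<Longrightarrow> fscale \<mu> (S f) - T (S f) = f"
    using inverse_of_shift[OF assms(1)] by metis
  have "resolvent H T \<mu> f = S f"
    by (auto intro!: resolvent_eqI assms bounded_op_mem[OF S(1)] S(2))
  then show ?thesis using S(2) assms by simp
qed

text \<open>\<open>(1 - \<nu>T)\<inverse>\<close> is \<open>\<mu>\<close> times the resolvent at \<open>\<mu>\<close>, in the coordinate \<open>\<nu> = 1/\<mu>\<close>, in which the exterior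
  of the closed disc together with the point at infinity becomes the open disc.\<close>

definition neumann :: "complex \<Rightarrow> 'n oper"
  where "neumann \<nu> f = (if \<nu> = 0 then f else fscale (1 / \<nu>) (resolvent H T (1 / \<nu>) f))"

lemma norm_inverse_gt_1: "\<nu> \<noteq> 0 \<Longrightarrow> cmod \<nu> < 1 \<Longrightarrow> 1 < cmod (1 / \<nu>)"
  by (simp add: norm_divide field_simps)

lemma bounded_neumann:
  assumes "cmod \<nu> < 1"
  shows "bounded_op H ip (neumann \<nu>)"
proof (cases "\<nu> = 0")
  case True
  then show ?thesis
    by (intro bounded_op_cong[OF bounded_op_lincomb[OF bounded, of 1 0]])
       (auto simp: neumann_def fun_eq_iff vec_eq_iff)
next
  case False
  then show ?thesis
    by (intro bounded_op_cong[OF bounded_op_lincomb[OF bounded_resolvent, of "1 / \<nu>" 0 "1 / \<nu>"]]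
          norm_inverse_gt_1 assms)
       (auto simp: neumann_def fun_eq_iff vec_eq_iff)
qed

lemma neumann_mem: "cmod \<nu> < 1 \<Longrightarrow> f \<in> H \<Longrightarrow> neumann \<nu> f \<in> H"
  by (rule bounded_op_mem[OF bounded_neumann])

lemma neumann_eq:
  assumes "cmod \<nu> < 1" "f \<in> H"
  shows "neumann \<nu> f - fscale \<nu> (T (neumann \<nu> f)) = f"
proof (cases "\<nu> = 0")
  case False
  define u where "u = resolvent H T (1 / \<nu>) f"
  have u: "u \<in> H" "fscale (1 / \<nu>) u - T u = f"
    using False assms by (auto simp: u_def intro!: resolvent_mem resolvent_eq norm_inverse_gt_1)
  have "neumann \<nu> f = fscale (1 / \<nu>) u" using False by (simp add: neumann_def u_def)
  then show ?thesis using u False by (simp add: bounded_op_fscale[OF bounded])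
qed (auto simp: neumann_def fun_eq_iff vec_eq_iff)

lemma neumann_eqI:
  assumes "cmod \<nu> < 1" "u \<in> H" "u - fscale \<nu> (T u) = f"
  shows "neumann \<nu> f = u"
proof (cases "\<nu> = 0")
  case True
  then show ?thesis using assms by (auto simp: neumann_def fun_eq_iff vec_eq_iff)
next
  case False
  have "resolvent H T (1 / \<nu>) f = fscale \<nu> u"
    using False assms
    by (intro resolvent_eqI norm_inverse_gt_1) (auto simp: scale_mem bounded_op_fscale[OF bounded])
  then show ?thesis using False by (simp add: neumann_def)
qed

lemma neumann_identity:
  assumes "cmod \<nu> < 1" "cmod \<nu>' < 1" "f \<in> H"
  shows "neumann \<nu> f - neumann \<nu>' f = fscale (\<nu> - \<nu>') (neumann \<nu>' (T (neumann \<nu> f)))"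
proof -
  define u where "u = neumann \<nu> f"
  have u: "u \<in> H" "u - fscale \<nu> (T u) = f"
    using assms by (simp_all add: u_def neumann_mem neumann_eq)
  have Tu: "T u \<in> H" by (rule bounded_op_mem[OF bounded u(1)])
  have "neumann \<nu>' (f + fscale (\<nu> - \<nu>') (T u)) = u"
    by (rule neumann_eqI[OF assms(2) u(1)]) (auto simp: u(2)[symmetric] fun_eq_iff vec_eq_iff algebra_simps)
  moreover have "neumann \<nu>' (f + fscale (\<nu> - \<nu>') (T u))
      = neumann \<nu>' f + fscale (\<nu> - \<nu>') (neumann \<nu>' (T u))"
    using assms Tu
    by (simp add: bounded_op_plus[OF bounded_neumann] bounded_op_fscale[OF bounded_neumann] scale_mem)
  ultimately show ?thesis by (simp add: u_def[symmetric] algebra_simps)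
qed

text \<open>Once \<open>\<bar>\<nu> - \<nu>\<^sub>0\<bar> \<parallel>(1 - \<nu>\<^sub>0T)\<inverse>\<parallel> \<parallel>T\<parallel> \<le> 1/2\<close>, the resolvent identity bounds \<open>(1 - \<nu>T)\<inverse>\<close> by
  \<open>2 \<parallel>(1 - \<nu>\<^sub>0T)\<inverse>\<parallel>\<close>, and inserting this bound once more gives continuity.\<close>

lemma neumann_continuous:
  assumes \<nu>0: "cmod \<nu>0 < 1" and f: "f \<in> H"
  shows "((\<lambda>\<nu>. hnorm ip (neumann \<nu> f - neumann \<nu>0 f)) \<longlongrightarrow> 0) (at \<nu>0)"
proof -
  obtain C where C0: "0 \<le> C" and C: "\<And>f. f \<in> H \<Longrightarrow> hnorm ip (neumann \<nu>0 f) \<le> C * hnorm ip f"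
    using bounded_op_bound[OF bounded_neumann[OF \<nu>0]] by blast
  obtain B where B0: "0 \<le> B" and B: "\<And>f. f \<in> H \<Longrightarrow> hnorm ip (T f) \<le> B * hnorm ip f"
    using bounded_op_bound[OF bounded] by blast
  have bound: "hnorm ip (neumann \<nu> f - neumann \<nu>0 f) \<le> cmod (\<nu> - \<nu>0) * (C * B * (2 * C * hnorm ip f))"
    if \<nu>: "cmod \<nu> < 1" and close: "cmod (\<nu> - \<nu>0) * (C * B) < 1 / 2" for \<nu>
  proof -
    define u where "u = neumann \<nu> f"
    have u: "u \<in> H" by (simp add: u_def neumann_mem \<nu> f)
    have n0: "neumann \<nu>0 f \<in> H" by (simp add: neumann_mem \<nu>0 f)
    have Tu: "T u \<in> H" by (rule bounded_op_mem[OF bounded u])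
    have "hnorm ip (neumann \<nu>0 (T u)) \<le> C * B * hnorm ip u"
      using C[OF Tu] mult_left_mono[OF B[OF u] C0] by simp
    then have *: "hnorm ip (u - neumann \<nu>0 f) \<le> cmod (\<nu> - \<nu>0) * (C * B * hnorm ip u)"
      using neumann_identity[OF \<nu> \<nu>0 f]
      by (simp add: u_def[symmetric] hnorm_scale neumann_mem \<nu>0 Tu mult_left_mono)
    have "cmod (\<nu> - \<nu>0) * (C * B * hnorm ip u) \<le> 1 / 2 * hnorm ip u"
      using mult_right_mono[OF less_imp_le[OF close] hnorm_nonneg[OF u]] by (simp add: mult.assoc)
    moreover have "hnorm ip u \<le> hnorm ip (u - neumann \<nu>0 f) + hnorm ip (neumann \<nu>0 f)"
      using hnorm_triangle[OF diff_mem[OF u n0] n0] by simp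
    ultimately have "hnorm ip u \<le> 2 * C * hnorm ip f"
      using * C[OF f] by simp
    then have "cmod (\<nu> - \<nu>0) * (C * B * hnorm ip u) \<le> cmod (\<nu> - \<nu>0) * (C * B * (2 * C * hnorm ip f))"
      by (intro mult_left_mono mult_nonneg_nonneg C0 B0 norm_ge_zero)
    then show ?thesis using * by (simp add: u_def)
  qed
  have ev1: "\<forall>\<^sub>F \<nu> in at \<nu>0. cmod \<nu> < 1"
    by (rule order_tendstoD(2)[OF _ \<nu>0]) (intro tendsto_intros)
  have "((\<lambda>\<nu>. cmod (\<nu> - \<nu>0) * (C * B)) \<longlongrightarrow> cmod (\<nu>0 - \<nu>0) * (C * B)) (at \<nu>0)"
    by (intro tendsto_intros)
  then have ev2: "\<forall>\<^sub>F \<nu> in at \<nu>0. cmod (\<nu> - \<nu>0) * (C * B) < 1 / 2"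
    by (rule order_tendstoD(2)) simp
  have lim: "((\<lambda>\<nu>. cmod (\<nu> - \<nu>0) * (C * B * (2 * C * hnorm ip f))) \<longlongrightarrow> 
      cmod (\<nu>0 - \<nu>0) * (C * B * (2 * C * hnorm ip f))) (at \<nu>0)"
    by (intro tendsto_intros)
  show ?thesis
  proof (rule Lim_null_comparison)
    show "\<forall>\<^sub>F \<nu> in at \<nu>0. norm (hnorm ip (neumann \<nu> f - neumann \<nu>0 f))
        \<le> cmod (\<nu> - \<nu>0) * (C * B * (2 * C * hnorm ip f))"
      using ev1 ev2
      by eventually_elim (use bound hnorm_nonneg[OF diff_mem[OF neumann_mem[OF _ f] neumann_mem[OF \<nu>0 f]]] in auto)
  qed (use lim in simp)
qed

lemma neumann_weakly_holomorphic:
  assumes f: "f \<in> H" and h: "h \<in> H"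
  shows "(\<lambda>\<nu>. ip (neumann \<nu> f) h) holomorphic_on ball 0 1"
proof (rule holomorphic_onI)
  fix \<nu>0 :: complex assume "\<nu>0 \<in> ball 0 1"
  then have \<nu>0: "cmod \<nu>0 < 1" by simp
  let ?P = "\<lambda>g. neumann \<nu>0 (T g)"
  have P: "bounded_op H ip ?P"
    by (rule bounded_op_comp[OF bounded_neumann[OF \<nu>0] bounded])
  obtain C where C: "\<And>f. f \<in> H \<Longrightarrow> hnorm ip (?P f) \<le> C * hnorm ip f"
    using bounded_op_bound[OF P] by metis
  have ev1: "\<forall>\<^sub>F \<nu> in at \<nu>0. cmod \<nu> < 1"
    by (rule order_tendstoD(2)[OF _ \<nu>0]) (intro tendsto_intros)
  have lim: "((\<lambda>\<nu>. C * hnorm ip (neumann \<nu> f - neumann \<nu>0 f) * hnorm ip h) \<longlongrightarrow> C * 0 * hnorm ip h) (at \<nu>0)"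
    by (intro tendsto_intros neumann_continuous \<nu>0 f)
  have "((\<lambda>\<nu>. ip (?P (neumann \<nu> f)) h) \<longlongrightarrow> ip (?P (neumann \<nu>0 f)) h) (at \<nu>0)"
  proof (rule LIM_zero_cancel, rule Lim_null_comparison)
    show "\<forall>\<^sub>F \<nu> in at \<nu>0. norm (ip (?P (neumann \<nu> f)) h - ip (?P (neumann \<nu>0 f)) h)
        \<le> C * hnorm ip (neumann \<nu> f - neumann \<nu>0 f) * hnorm ip h"
      using ev1
    proof eventually_elim
      case (elim \<nu>)
      have m: "neumann \<nu> f \<in> H" "neumann \<nu>0 f \<in> H" using elim \<nu>0 f by (auto intro: neumann_mem)
      have "norm (ip (?P (neumann \<nu> f)) h - ip (?P (neumann \<nu>0 f)) h)
          = norm (ip (?P (neumann \<nu> f - neumann \<nu>0 f)) h)"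
        using m by (simp add: bounded_op_diff[OF P] ip_diff bounded_op_mem[OF P] h)
      also have "\<dots> \<le> hnorm ip (?P (neumann \<nu> f - neumann \<nu>0 f)) * hnorm ip h"
        by (rule Cauchy_Schwarz[OF bounded_op_mem[OF P diff_mem[OF m]] h])
      also have "\<dots> \<le> C * hnorm ip (neumann \<nu> f - neumann \<nu>0 f) * hnorm ip h"
        by (rule mult_right_mono[OF C[OF diff_mem[OF m]] hnorm_nonneg[OF h]])
      finally show ?case .
    qed
  qed (use lim in simp)
  moreover have "\<forall>\<^sub>F \<nu> in at \<nu>0. ip (?P (neumann \<nu> f)) h = (ip (neumann \<nu> f) h - ip (neumann \<nu>0 f) h) / (\<nu> - \<nu>0)"
    using ev1 eventually_neq_at_within[of \<nu>0 \<nu>0 UNIV]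
  proof eventually_elim
    case (elim \<nu>)
    have m: "neumann \<nu> f \<in> H" "neumann \<nu>0 f \<in> H" using elim \<nu>0 f by (auto intro: neumann_mem)
    have "ip (neumann \<nu> f) h - ip (neumann \<nu>0 f) h = (\<nu> - \<nu>0) * ip (?P (neumann \<nu> f)) h"
      using neumann_identity[OF elim(1) \<nu>0 f] m
      by (simp add: ip_diff[symmetric] h ip_scale bounded_op_mem[OF P])
    then show ?case using elim by simp
  qed
  ultimately have "((\<lambda>\<nu>. (ip (neumann \<nu> f) h - ip (neumann \<nu>0 f) h) / (\<nu> - \<nu>0))
      \<longlongrightarrow> ip (?P (neumann \<nu>0 f)) h) (at \<nu>0)"
    by (rule Lim_transform_eventually)
  then have "((\<lambda>\<nu>. ip (neumann \<nu> f) h) has_field_derivative ip (?P (neumann \<nu>0 f)) h) (at \<nu>0)"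
    by (simp add: has_field_derivative_iff)
  then show "(\<lambda>\<nu>. ip (neumann \<nu> f) h) field_differentiable at \<nu>0 within ball 0 1"
    using field_differentiable_at_within field_differentiable_def by blast
qed

text \<open>The calculus reproduces the constant function 1. The substitution \<open>\<mu> = 1/\<nu>\<close> turns the integral
  into Cauchy's formula for the value at \<open>\<nu> = 0\<close> of the holomorphic function
  \<open>\<langle>(1 - \<nu>T)\<inverse>f, h\<rangle>\<close>.\<close>

lemma resolvent_integral:
  assumes r: "1 < r" and f: "f \<in> H" and h: "h \<in> H"
  shows "((\<lambda>\<mu>. ip (resolvent H T \<mu> f) h) has_contour_integral (2 * of_real pi * \<i> * ip f h)) (circlepath 0 r)"
proof -
  define G where "G \<nu> = ip (neumann \<nu> f) h" for \<nu>
  have "1 / r < 1" using r by simp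
  then have "cball 0 (1 / r) \<subseteq> ball (0 :: complex) 1" by (auto simp only: mem_cball mem_ball)
  then have "G holomorphic_on cball 0 (1 / r)"
    unfolding G_def by (rule holomorphic_on_subset[OF neumann_weakly_holomorphic[OF f h]])
  from Cauchy_integral_circlepath_simple[OF this, of 0]
  have "((\<lambda>u. G u / u) has_contour_integral (2 * of_real pi * \<i> * ip f h)) (part_circlepath 0 (1 / r) 0 (2 * pi))"
    using r by (simp add: circlepath_def G_def neumann_def)
  then have "((\<lambda>t. \<i> * G (cis t / r)) has_integral (2 * of_real pi * \<i> * ip f h)) {0..2*pi}"
    using r by (subst (asm) has_contour_integral_part_circlepath_iff) (auto simp: mult.commute)
  from has_integral_affinity[OF this[unfolded cbox_interval[symmetric]], of "-1" "2 * pi"]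
  have "((\<lambda>t. \<i> * G (cis (2 * pi - t) / r)) has_integral (2 * of_real pi * \<i> * ip f h)) {0..2*pi}"
    by simp
  also have "?this \<longleftrightarrow> ((\<lambda>t. ip (resolvent H T (r * cis t) f) h * r * \<i> * cis t) 
      has_integral (2 * of_real pi * \<i> * ip f h)) {0..2*pi}"
  proof (rule has_integral_cong)
    fix t
    have "cis (2 * pi - t) = inverse (cis t)"
      by (simp add: cis_inverse complex_eq_iff)
    then have c: "complex_of_real r / cis (2 * pi - t) = r * cis t"
      by (simp add: field_simps)
    have "1 < cmod (r * cis t)" using r by (simp add: norm_mult)
    then have "resolvent H T (r * cis t) f \<in> H" by (rule resolvent_mem[OF _ f])
    then show "\<i> * G (cis (2 * pi - t) / r) = ip (resolvent H T (r * cis t) f) h * r * \<i> * cis t"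
      using r by (simp add: G_def neumann_def c ip_scale h)
  qed
  finally show ?thesis
    unfolding circlepath_def by (subst has_contour_integral_part_circlepath_iff) auto
qed

end


section \<open>The functional calculus at a Moebius map\<close>

text \<open>With \<open>f = (1 - cnj a T) u\<close> the integrand \<open>F(\<mu>)(\<mu> - T)\<inverse> f\<close> is the resolvent applied to the fixed
  vector \<open>c (T - a) u\<close> plus a function of \<open>\<mu>\<close> that is holomorphic near the closed disc, whose
  integral vanishes. So the integral is known as soon as that of the resolvent is.\<close>

lemma (in disc_operator) disc_calculus_Moebius:
  assumes a: "cmod a < 1" and \<phi>: "\<And>z. z \<in> \<bbbD> \<Longrightarrow> \<phi> z = c * (z - a) / (1 - cnj a * z)"
  shows "disc_calculus H ip T \<phi>
    (\<lambda>f. fscale (- c * a) (neumann (cnj a) f) + fscale c (T (neumann (cnj a) f)))"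
    (is "disc_calculus H ip T \<phi> ?A")
proof -
  have a': "cmod (cnj a) < 1" using a by simp
  define F where "F z = c * (z - a) / (1 - cnj a * z)" for z
  (* R lies strictly between 1 and the modulus of the pole 1 / cnj a; for a = 0 there is no pole *)
  define R where "R = 2 / (1 + cmod a)"
  define r where "r = (1 + R) / 2"
  have "1 < R" using a by (simp add: R_def field_simps add_pos_nonneg)
  then have r: "1 < r" "r < R" by (simp_all add: r_def)
  have nz: "1 - cnj a * z \<noteq> 0" if "z \<in> ball 0 R" for z
  proof -
    have "cmod (cnj a * z) \<le> cmod a * R"
      using that by (auto simp: norm_mult intro!: mult_left_mono)
    also have "\<dots> < 1" using a by (simp add: R_def field_simps add_pos_nonneg)
    finally show ?thesis by auto
  qed
  have F: "F holomorphic_on ball 0 R"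
    unfolding F_def by (intro holomorphic_intros nz)
  have bounded_A: "bounded_op H ip ?A"
    by (rule bounded_op_comp[OF bounded_op_lincomb[OF bounded] bounded_neumann[OF a']])
  have "((\<lambda>\<mu>. F \<mu> * ip (resolvent H T \<mu> f) h)
      has_contour_integral (2 * of_real pi * \<i> * ip (?A f) h)) (circlepath 0 r)"
    if f: "f \<in> H" and h: "h \<in> H" for f h
  proof -
    define u where "u = neumann (cnj a) f"
    have u: "u \<in> H" "u - fscale (cnj a) (T u) = f"
      using a' f by (simp_all add: u_def neumann_mem neumann_eq)
    have Tu: "T u \<in> H" by (rule bounded_op_mem[OF bounded u(1)])
    have Af: "?A f = fscale (- c * a) u + fscale c (T u)" by (simp add: u_def)
    have AfH: "?A f \<in> H" unfolding Af by (intro add_mem scale_mem u Tu)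
    have image: "path_image (circlepath 0 r) \<subseteq> ball 0 R" using r by auto
    have "((\<lambda>\<mu>. (c + cnj a * F \<mu>) * ip u h) has_contour_integral 0) (circlepath 0 r)"
      by (rule Cauchy_theorem_disc_simple[of _ 0 R]) (use image in \<open>auto intro!: holomorphic_intros F\<close>)
    from has_contour_integral_add[OF resolvent_integral[OF r(1) AfH h] this]
    have "((\<lambda>\<mu>. ip (resolvent H T \<mu> (?A f)) h + (c + cnj a * F \<mu>) * ip u h)
        has_contour_integral (2 * of_real pi * \<i> * ip (?A f) h)) (circlepath 0 r)"
      by simp
    then show ?thesis
    proof (rule has_contour_integral_eq)
      fix \<mu> assume "\<mu> \<in> path_image (circlepath 0 r)"
      then have \<mu>: "1 < cmod \<mu>" and nz': "1 - cnj a * \<mu> \<noteq> 0"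
        using r nz by auto
      define v where "v = resolvent H T \<mu> u"
      have v: "v \<in> H" "fscale \<mu> v - T v = u"
        unfolding v_def by (auto intro!: resolvent_mem resolvent_eq \<mu> u)
      have Tv: "T v \<in> H" by (rule bounded_op_mem[OF bounded v(1)])
      have Tv_eq: "T v = fscale \<mu> v - u"
        using v(2) by (simp add: algebra_simps)
      have res_f: "resolvent H T \<mu> f = fscale (1 - cnj a * \<mu>) v + fscale (cnj a) u"
      proof (rule resolvent_eqI[OF \<mu>])
        have "T (fscale (1 - cnj a * \<mu>) v + fscale (cnj a) u)
            = fscale (1 - cnj a * \<mu>) (T v) + fscale (cnj a) (T u)"
          by (simp add: bounded_op_plus[OF bounded] bounded_op_fscale[OF bounded] scale_mem u v)
        then show "fscale \<mu> (fscale (1 - cnj a * \<mu>) v + fscale (cnj a) u)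
            - T (fscale (1 - cnj a * \<mu>) v + fscale (cnj a) u) = f"
          by (simp add: Tv_eq u(2)[symmetric] fun_eq_iff vec_eq_iff algebra_simps)
      qed (intro add_mem scale_mem u v)
      have res_A: "resolvent H T \<mu> (?A f) = fscale (c * (\<mu> - a)) v + fscale (- c) u"
      proof (rule resolvent_eqI[OF \<mu>])
        have "T (fscale (c * (\<mu> - a)) v + fscale (- c) u) = fscale (c * (\<mu> - a)) (T v) + fscale (- c) (T u)"
          by (simp add: bounded_op_plus[OF bounded] bounded_op_fscale[OF bounded] scale_mem u v)
        then show "fscale \<mu> (fscale (c * (\<mu> - a)) v + fscale (- c) u)
            - T (fscale (c * (\<mu> - a)) v + fscale (- c) u) = ?A f"
          unfolding Af by (simp add: Tv_eq fun_eq_iff vec_eq_iff algebra_simps)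
      qed (intro add_mem scale_mem u v)
      show "ip (resolvent H T \<mu> (?A f)) h + (c + cnj a * F \<mu>) * ip u h = F \<mu> * ip (resolvent H T \<mu> f) h"
        unfolding res_A res_f using nz'
        by (simp add: ip_add ip_scale scale_mem u v h F_def divide_simps) (simp add: algebra_simps)
    qed
  qed
  then show ?thesis
    unfolding disc_calculus_def using bounded_A r F
    by (intro conjI exI[of _ F] exI[of _ r] exI[of _ R]) (auto simp: F_def \<phi>)
qed


section \<open>Automorphisms of the disc\<close>

lemma Mob_mem: "\<phi> \<in> Mob \<Longrightarrow> z \<in> \<bbbD> \<Longrightarrow> \<phi> z \<in> \<bbbD>"
  by (auto simp: Mob_def bij_betw_def)

lemma Mob_inv_inv: "\<phi> \<in> Mob \<Longrightarrow> z \<in> \<bbbD> \<Longrightarrow> inv_into \<bbbD> (inv_into \<bbbD> \<phi>) z = \<phi> z"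
  by (rule inv_into_inv_into_eq) (simp_all add: Mob_def)

lemma Mob_inv:
  assumes "\<phi> \<in> Mob"
  shows "inv_into \<bbbD> \<phi> \<in> Mob"
proof -
  have "inv_into \<bbbD> (inv_into \<bbbD> \<phi>) holomorphic_on \<bbbD>"
    using assms by (subst holomorphic_cong[OF refl Mob_inv_inv[OF assms]]) (auto simp: Mob_def)
  then show ?thesis
    using assms by (auto simp: Mob_def bij_betw_inv_into)
qed

lemma Moebius_function_Mob:
  assumes "cmod a < 1"
  shows "Moebius_function 0 a \<in> Mob"
proof -
  have left: "Moebius_function 0 (- a) (Moebius_function 0 a z) = z" if "z \<in> \<bbbD>" for z
    using Moebius_function_compose[of "- a" a z] assms that by simp
  have right: "Moebius_function 0 a (Moebius_function 0 (- a) z) = z" if "z \<in> \<bbbD>" for z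
    using Moebius_function_compose[of a "- a" z] assms that by simp
  have maps: "Moebius_function 0 b z \<in> \<bbbD>" if "cmod b < 1" "z \<in> \<bbbD>" for b z
    using Moebius_function_norm_lt_1[of b z] that by simp
  have bij: "bij_betw (Moebius_function 0 a) \<bbbD> \<bbbD>"
    by (rule bij_betw_byWitness[where f' = "Moebius_function 0 (- a)"])
       (use left right maps assms in auto)
  have inv: "inv_into \<bbbD> (Moebius_function 0 a) z = Moebius_function 0 (- a) z" if "z \<in> \<bbbD>" for z
    by (rule inv_into_f_eq) (use bij right maps assms that in \<open>auto simp: bij_betw_def\<close>)
  have "Moebius_function 0 (- a) holomorphic_on \<bbbD>"
    using Moebius_function_holomorphic assms by simp
  then have "inv_into \<bbbD> (Moebius_function 0 a) holomorphic_on \<bbbD>"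
    by (rule holomorphic_transform) (rule inv[symmetric])
  then show ?thesis
    using bij Moebius_function_holomorphic[OF assms] by (simp add: Mob_def)
qed

text \<open>Composing with a Moebius map moves the zero of \<open>\<phi>\<close> to the origin; an automorphism fixing the
  origin is a rotation, since the Schwarz lemma applies to it and to its inverse.\<close>

lemma Mob_explicit:
  assumes "\<phi> \<in> Mob"
  obtains a c where "cmod a < 1" "\<And>z. z \<in> \<bbbD> \<Longrightarrow> \<phi> z = c * (z - a) / (1 - cnj a * z)"
proof -
  define \<psi> where "\<psi> = inv_into \<bbbD> \<phi>"
  have hol: "\<phi> holomorphic_on \<bbbD>" "\<psi> holomorphic_on \<bbbD>" and bij: "bij_betw \<phi> \<bbbD> \<bbbD>"
    using assms by (auto simp: Mob_def \<psi>_def)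
  have \<phi>\<psi>: "\<phi> (\<psi> z) = z" and \<psi>\<phi>: "\<psi> (\<phi> z) = z" if "z \<in> \<bbbD>" for z
    using bij that by (auto simp: \<psi>_def bij_betw_def f_inv_into_f)
  have \<phi>D: "\<phi> z \<in> \<bbbD>" and \<psi>D: "\<psi> z \<in> \<bbbD>" if "z \<in> \<bbbD>" for z
    using Mob_mem[OF assms that] Mob_mem[OF Mob_inv[OF assms] that] by (auto simp: \<psi>_def)
  define a where "a = \<psi> 0"
  have a: "cmod a < 1" using \<psi>D[of 0] by (simp add: a_def)
  let ?M = "Moebius_function 0 a" and ?N = "Moebius_function 0 (- a)"
  have MD: "?M z \<in> \<bbbD>" and ND: "?N z \<in> \<bbbD>" if "z \<in> \<bbbD>" for z
    using Moebius_function_norm_lt_1[of a z] Moebius_function_norm_lt_1[of "- a" z] a that by auto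
  have NM: "?N (?M z) = z" and MN: "?M (?N z) = z" if "z \<in> \<bbbD>" for z
    using Moebius_function_compose[of "- a" a z] Moebius_function_compose[of a "- a" z] a that by auto
  have Mhol: "?M holomorphic_on \<bbbD>" "?N holomorphic_on \<bbbD>"
    using Moebius_function_holomorphic[of a 0] Moebius_function_holomorphic[of "- a" 0] a by auto
  define f where "f = \<phi> \<circ> ?N"
  define g where "g = ?M \<circ> \<psi>"
  have fhol: "f holomorphic_on \<bbbD>"
    unfolding f_def by (rule holomorphic_on_compose_gen[OF Mhol(2) hol(1)]) (use ND in auto)
  have ghol: "g holomorphic_on \<bbbD>"
    unfolding g_def by (rule holomorphic_on_compose_gen[OF hol(2) Mhol(1)]) (use \<psi>D in auto)
  have f0: "f 0 = 0" using \<phi>\<psi>[of 0] by (simp add: f_def a_def Moebius_function_of_zero)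
  have g0: "g 0 = 0" by (simp add: g_def a_def Moebius_function_eq_zero)
  have fD: "cmod (f z) < 1" and gD: "cmod (g z) < 1" if "cmod z < 1" for z
    using \<phi>D[OF ND, of z] MD[OF \<psi>D, of z] that by (auto simp: f_def g_def)
  have gf: "g (f z) = z" if "cmod z < 1" for z
    using that ND MN \<psi>\<phi> by (simp add: f_def g_def)
  (* equality in the Schwarz lemma at one nonzero point, here 1/2, makes f a rotation *)
  have "cmod (f (1/2)) = cmod (1/2)"
  proof (rule antisym)
    show "cmod (f (1/2)) \<le> cmod (1/2)"
      by (rule Schwarz_Lemma(1)[OF fhol f0 fD]) auto
    have "cmod (g (f (1/2))) \<le> cmod (f (1/2))"
      by (rule Schwarz_Lemma(1)[OF ghol g0 gD]) (auto intro!: fD)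
    then show "cmod (1/2) \<le> cmod (f (1/2))" using gf[of "1/2"] by simp
  qed
  then have "\<exists>z. cmod z < 1 \<and> z \<noteq> 0 \<and> cmod (f z) = cmod z"
    by (intro exI[of _ "1/2"]) auto
  then obtain c where c: "\<And>z. cmod z < 1 \<Longrightarrow> f z = c * z"
    using Schwarz_Lemma(3)[OF fhol f0 fD, of 0] by auto
  have "\<phi> z = c * (z - a) / (1 - cnj a * z)" if "z \<in> \<bbbD>" for z
    using c[of "?M z"] MD[OF that] NM[OF that] by (simp add: f_def Moebius_function_simple)
  then show ?thesis using that a by blast
qed


section \<open>Weighted compositions intertwine multiplication operators\<close>

context hilbert_function_space
begin

lemma eq_on_discI:
  assumes "f \<in> H" "g \<in> H" "\<And>z. z \<in> \<bbbD> \<Longrightarrow> f z = g z"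
  shows "f = g"
  using assms zero_off_disc by (metis ext)

text \<open>If \<open>W f = g (f \<circ> \<phi>)\<close>, then \<open>W M\<^sub>z = M\<^sub>\<phi> W\<close>, because composition with \<open>\<phi>\<close> turns the scalar factor
  \<open>z\<close> into \<open>\<phi>\<close> and the matrix weight commutes with scalars.\<close>

lemma weighted_comp_intertwines:
  assumes W: "inverse_ops H ip S (weighted_comp g \<psi>)" and \<psi>: "\<And>z. z \<in> \<bbbD> \<Longrightarrow> \<psi> z = \<phi> z"
    and f: "f \<in> H" and z: "z \<in> \<bbbD>"
  shows "weighted_comp g \<psi> (mult_z (S f)) z = \<phi> z *s f z"
proof -
  have "weighted_comp g \<psi> (mult_z (S f)) z = \<phi> z *s weighted_comp g \<psi> (S f) z"
    using z by (simp add: weighted_comp_def mult_z_def vector_scalar_commute \<psi>)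
  then show ?thesis using W f by (simp add: inverse_ops_def)
qed

text \<open>The multiplier \<open>\<psi>(z) = (z - a) / (1 - cnj a z)\<close> satisfies \<open>1 + cnj a \<psi>(z) = (1 - \<bar>a\<bar>\<^sup>2) / (1 - cnj a z)\<close>.
  So boundedness of \<open>M\<^sub>\<psi>\<close> for every Moebius map \<open>\<psi>\<close> makes \<open>M\<^sub>z - \<mu>\<close> invertible for every \<open>\<mu> = 1 / cnj a\<close>
  outside the closed disc.\<close>

lemma spectrum_mult_z:
  assumes T: "bounded_op H ip mult_z"
    and mult: "\<And>\<phi>. \<phi> \<in> Mob \<Longrightarrow> \<exists>B. bounded_op H ip B \<and> (\<forall>f\<in>H. \<forall>z\<in>\<bbbD>. B f z = \<phi> z *s f z)"
  shows "op_spectrum H ip mult_z \<subseteq> cball 0 1"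
proof
  fix \<mu> assume spec: "\<mu> \<in> op_spectrum H ip mult_z"
  show "\<mu> \<in> cball 0 1"
  proof (rule ccontr)
    assume "\<mu> \<notin> cball 0 1"
    then have \<mu>: "1 < cmod \<mu>" by simp
    define a where "a = 1 / cnj \<mu>"
    define k where "k = cnj a / (1 - a * cnj a)"
    have a: "cmod a < 1" using \<mu> by (auto simp: a_def norm_divide divide_less_eq)
    obtain B where B: "bounded_op H ip B"
      and Bz: "\<And>f z. f \<in> H \<Longrightarrow> z \<in> \<bbbD> \<Longrightarrow> B f z = Moebius_function 0 a z *s f z"
      using mult[OF Moebius_function_Mob[OF a]] by blast
    let ?P = "\<lambda>f. fscale \<mu> f - mult_z f"
    let ?V = "\<lambda>f. fscale k f + fscale (k * cnj a) (B f)"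
    have scalar: "(k + k * cnj a * Moebius_function 0 a z) * (\<mu> - z) = 1" if z: "z \<in> \<bbbD>" for z
    proof -
      have "\<mu> \<noteq> 0" "\<mu> \<noteq> z" using \<mu> z by auto
      have "cmod (a * cnj a) < 1" using norm_mult_less[of a 1 "cnj a" 1] a by simp
      then have n1: "1 - a * cnj a \<noteq> 0" by auto
      have ca: "cnj a = 1 / \<mu>" by (simp add: a_def)
      have "1 - cnj a * z \<noteq> 0" using \<open>\<mu> \<noteq> 0\<close> \<open>\<mu> \<noteq> z\<close> by (simp add: ca field_simps)
      then have "k + k * cnj a * Moebius_function 0 a z = k * ((1 - a * cnj a) / (1 - cnj a * z))"
        by (simp add: Moebius_function_simple field_simps)
      also have "\<dots> = cnj a / (1 - cnj a * z)" using n1 by (simp add: k_def)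
      finally show ?thesis using \<open>\<mu> \<noteq> 0\<close> \<open>\<mu> \<noteq> z\<close> by (simp add: ca field_simps)
    qed
    have P: "bounded_op H ip ?P"
      by (rule bounded_op_cong[OF bounded_op_lincomb[OF T, of \<mu> "- 1"]]) (rule diff_conv_fscale)
    have V: "bounded_op H ip ?V" by (rule bounded_op_lincomb[OF B])
    have "?V (?P f) = f" if f: "f \<in> H" for f
    proof (rule eq_on_discI)
      fix z assume z: "z \<in> \<bbbD>"
      have "?V (?P f) z = (k + k * cnj a * Moebius_function 0 a z) *s ?P f z"
        by (simp only: plus_fun_apply fscale_apply Bz[OF bounded_op_mem[OF P f] z] vector_smult_assoc
            vector_sadd_rdistrib)
      also have "?P f z = (\<mu> - z) *s f z"
        by (simp add: mult_z_def vec_eq_iff algebra_simps)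
      finally have "?V (?P f) z = ((k + k * cnj a * Moebius_function 0 a z) * (\<mu> - z)) *s f z"
        by (simp only: vector_smult_assoc)
      then show "?V (?P f) z = f z" using scalar[OF z] by simp
    qed (rule bounded_op_mem[OF V bounded_op_mem[OF P f]], rule f)
    moreover have "?P (?V f) = f" if f: "f \<in> H" for f
    proof (rule eq_on_discI)
      fix z assume z: "z \<in> \<bbbD>"
      have "?P (?V f) z = (\<mu> - z) *s ?V f z"
        by (simp add: mult_z_def vec_eq_iff algebra_simps)
      also have "?V f z = (k + k * cnj a * Moebius_function 0 a z) *s f z"
        by (simp only: plus_fun_apply fscale_apply Bz[OF f z] vector_smult_assoc vector_sadd_rdistrib)
      finally have "?P (?V f) z = ((k + k * cnj a * Moebius_function 0 a z) * (\<mu> - z)) *s f z"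
        by (simp only: vector_smult_assoc mult.commute)
      then show "?P (?V f) z = f z" using scalar[OF z] by simp
    qed (rule bounded_op_mem[OF P bounded_op_mem[OF V f]], rule f)
    ultimately have "inverse_ops H ip ?V ?P"
      using P V by (simp add: inverse_ops_def)
    then show False using spec by (auto simp: op_spectrum_def bounded_invertible_op_def)
  qed
qed

text \<open>Composition with the inverse of an automorphism \<open>\<alpha>\<close> conjugates \<open>M\<^sub>z\<close> to multiplication by
  the inverse of \<open>\<alpha>\<close>. To reach \<open>M\<^sub>\<phi>\<close>, the hypothesis is therefore used for \<open>\<alpha>\<close> the inverse of \<open>\<phi>\<close>. The conjugated
  operators give the spectral inclusion, and each of them agrees with the value of the functional
  calculus because both multiply by \<open>\<phi>\<close>.\<close>

lemma weakly_homogeneous_if_weighted_compositions: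
  assumes T: "bounded_op H ip mult_z"
    and hyp: "\<And>\<phi>. \<phi> \<in> Mob \<Longrightarrow> \<exists>g. bounded_invertible_op H ip (weighted_comp g (inv_into \<bbbD> \<phi>))"
  shows "weakly_homogeneous H ip mult_z"
proof -
  have intertwine: "\<exists>W S. inverse_ops H ip S W \<and> (\<forall>f\<in>H. \<forall>z\<in>\<bbbD>. W (mult_z (S f)) z = \<phi> z *s f z)"
    if "\<phi> \<in> Mob" for \<phi>
  proof -
    let ?\<psi> = "inv_into \<bbbD> (inv_into \<bbbD> \<phi>)"
    obtain g S where S: "inverse_ops H ip S (weighted_comp g ?\<psi>)"
      using hyp[OF Mob_inv[OF \<open>\<phi> \<in> Mob\<close>]] unfolding bounded_invertible_op_def by blast
    have "weighted_comp g ?\<psi> (mult_z (S f)) z = \<phi> z *s f z" if "f \<in> H" "z \<in> \<bbbD>" for f z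
      by (rule weighted_comp_intertwines[OF S Mob_inv_inv[OF \<open>\<phi> \<in> Mob\<close>] that])
    then show ?thesis
      using S by (intro exI[of _ "weighted_comp g ?\<psi>"] exI[of _ S]) blast
  qed
  have "\<exists>B. bounded_op H ip B \<and> (\<forall>f\<in>H. \<forall>z\<in>\<bbbD>. B f z = \<phi> z *s f z)" if "\<phi> \<in> Mob" for \<phi>
  proof -
    obtain W S where WS: "inverse_ops H ip S W"
      "\<forall>f\<in>H. \<forall>z\<in>\<bbbD>. W (mult_z (S f)) z = \<phi> z *s f z"
      using intertwine[OF \<open>\<phi> \<in> Mob\<close>] by blast
    have W: "bounded_op H ip W" and S: "bounded_op H ip S" using WS(1) by (auto simp: inverse_ops_def)
    have "bounded_op H ip (\<lambda>f. W (mult_z (S f)))"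
      by (rule bounded_op_comp[OF W bounded_op_comp[OF T S]])
    then show ?thesis using WS(2) by blast
  qed
  then have spec: "op_spectrum H ip mult_z \<subseteq> cball 0 1"
    by (rule spectrum_mult_z[OF T])
  interpret disc_operator H ip mult_z
    by unfold_locales (rule T, rule spec)
  have "\<exists>A. disc_calculus H ip mult_z \<phi> A \<and> similar_ops H ip A mult_z" if Mob: "\<phi> \<in> Mob" for \<phi>
  proof -
    obtain W S where WS: "inverse_ops H ip S W"
      and intertwine\<phi>: "\<And>f z. f \<in> H \<Longrightarrow> z \<in> \<bbbD> \<Longrightarrow> W (mult_z (S f)) z = \<phi> z *s f z"
      using intertwine[OF Mob] by blast
    have bW: "bounded_op H ip W" and bS: "bounded_op H ip S"
      using WS by (auto simp: inverse_ops_def)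
    obtain a c where a: "cmod a < 1" and \<phi>: "\<And>z. z \<in> \<bbbD> \<Longrightarrow> \<phi> z = c * (z - a) / (1 - cnj a * z)"
      using Mob_explicit[OF Mob] by metis
    have a': "cmod (cnj a) < 1" using a by simp
    let ?A = "\<lambda>f. fscale (- c * a) (neumann (cnj a) f) + fscale c (mult_z (neumann (cnj a) f))"
    have calc: "disc_calculus H ip mult_z \<phi> ?A"
      using a \<phi> by (rule disc_calculus_Moebius)
    have "?A f = W (mult_z (S f))" if f: "f \<in> H" for f
    proof (rule eq_on_discI)
      show "?A f \<in> H" using calc f by (intro bounded_op_mem[of ?A]) (simp add: disc_calculus_def)
      show "W (mult_z (S f)) \<in> H" by (intro bounded_op_mem[OF bW] bounded_op_mem[OF T] bounded_op_mem[OF bS] f)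
      fix z assume z: "z \<in> \<bbbD>"
      define u where "u = neumann (cnj a) f z"
      have "f z = (1 - cnj a * z) *s u"
        by (subst neumann_eq[OF a' f, symmetric]) (simp add: u_def mult_z_def vec_eq_iff algebra_simps)
      then have "\<phi> z *s f z = (\<phi> z * (1 - cnj a * z)) *s u"
        by (simp only: vector_smult_assoc)
      moreover have "cmod (cnj a * z) < 1" using norm_mult_less[of "cnj a" 1 z 1] a z by simp
      then have "1 - cnj a * z \<noteq> 0" by auto
      then have "\<phi> z * (1 - cnj a * z) = c * (z - a)" using \<phi>[OF z] by simp
      ultimately have "\<phi> z *s f z = (c * (z - a)) *s u" by (simp only:)
      also have "\<dots> = ?A f z" by (simp add: u_def mult_z_def vec_eq_iff algebra_simps)
      finally show "?A f z = W (mult_z (S f)) z" using intertwine\<phi>[OF f z] by simp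
    qed
    then have "similar_ops H ip ?A mult_z"
      unfolding similar_ops_def using WS by blast
    then show ?thesis using calc by blast
  qed
  then show ?thesis
    using T spec by (simp add: weakly_homogeneous_def)
qed

end


section \<open>Matrix-valued holomorphic functions\<close>

lemma cdot_axis: "cdot x (axis i 1) = x $ i"
proof -
  have "cdot x (axis i 1) = (\<Sum>j\<in>UNIV. if j = i then x $ j else 0)"
    unfolding cdot_def by (intro sum.cong) (auto simp: axis_def)
  then show ?thesis by simp
qed

lemma matrix_vector_mult_axis: "(A *v axis j 1) $ i = (A $ i $ j :: complex)"
  by (simp add: matrix_vector_mult_def axis_def if_distrib cong: if_cong)

lemma holomorphic_det:
  fixes M :: "complex \<Rightarrow> complex ^ 'n::finite ^ 'n"
  assumes "\<And>i j. (\<lambda>w. M w $ i $ j) holomorphic_on S"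
  shows "(\<lambda>w. det (M w)) holomorphic_on S"
  unfolding det_def by (intro holomorphic_intros assms)

text \<open>Where the matrix \<open>M\<close> is invertible, Cramer's rule expresses the solution of the linear system as
  a quotient of determinants with holomorphic entries.\<close>

lemma holomorphic_solution:
  fixes M :: "complex \<Rightarrow> complex ^ 'n::finite ^ 'n" and x b :: "complex \<Rightarrow> complex ^ 'n"
  assumes S: "open S" "w \<in> S" and M: "\<And>i j. (\<lambda>w. M w $ i $ j) holomorphic_on S"
    and b: "\<And>i. (\<lambda>w. b w $ i) holomorphic_on S"
    and eq: "\<And>w. w \<in> S \<Longrightarrow> M w *v x w = b w" and nz: "det (M w) \<noteq> 0"
  shows "(\<lambda>w. x w $ i) field_differentiable at w"
proof -
  define U where "U = {w \<in> S. det (M w) \<noteq> 0}"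
  have det: "(\<lambda>w. det (M w)) holomorphic_on S" by (rule holomorphic_det[OF M])
  have "U = S \<inter> (\<lambda>w. det (M w)) -` (- {0})" by (auto simp: U_def)
  then have U: "open U" "w \<in> U" "U \<subseteq> S"
    using continuous_open_preimage[OF holomorphic_on_imp_continuous_on[OF det] S(1), of "- {0}"] S nz
    by (auto simp: U_def)
  define D where "D w = (\<chi> k j. if j = i then b w $ k else M w $ k $ j)" for w
  have D: "(\<lambda>w. D w $ k $ j) holomorphic_on S" for k j
    by (cases "j = i") (auto simp: D_def b M)
  have "x w $ i = det (D w) / det (M w)" if "w \<in> U" for w
    using that eq[of w] cramer[of "M w" "x w" "b w"] by (auto simp: U_def D_def)
  then have x: "det (D w) / det (M w) = x w $ i" if "w \<in> U" for w using that by simp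
  have "(\<lambda>w. det (D w) / det (M w)) holomorphic_on U"
    by (intro holomorphic_intros holomorphic_det holomorphic_on_subset[OF D U(3)]
        holomorphic_on_subset[OF M U(3)]) (auto simp: U_def)
  then have "(\<lambda>w. x w $ i) holomorphic_on U"
    by (rule holomorphic_transform) (rule x)
  then show ?thesis using U holomorphic_on_imp_differentiable_at by blast
qed


section \<open>Weighted compositions from similarities\<close>

context rkhs
begin

text \<open>Tested against a kernel function at \<open>w\<close>, the resolvent of \<open>M\<^sub>z\<close> is \<open>1/(\<mu> - w)\<close> times evaluation at
  \<open>w\<close>, so the Riesz-Dunford integral is Cauchy's formula for \<open>\<phi>(w)\<close>.\<close>

lemma disc_calculus_mult_z:
  assumes T: "bounded_op H ip mult_z" and spec: "op_spectrum H ip mult_z \<subseteq> cball 0 1"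
    and calc: "disc_calculus H ip mult_z \<phi> A" and f: "f \<in> H" and w: "w \<in> \<bbbD>"
  shows "A f w = \<phi> w *s f w"
proof -
  interpret disc_operator H ip mult_z
    by unfold_locales (rule T, rule spec)
  obtain F r R where A: "bounded_op H ip A" and r: "1 < r" "r < R" and F: "F holomorphic_on ball 0 R"
    and F\<phi>: "\<forall>z\<in>\<bbbD>. F z = \<phi> z"
    and int: "\<forall>f\<in>H. \<forall>h\<in>H. ((\<lambda>\<mu>. F \<mu> * ip (resolvent H mult_z \<mu> f) h)
        has_contour_integral (2 * of_real pi * \<i> * ip (A f) h)) (circlepath 0 r)"
    using calc unfolding disc_calculus_def by (elim conjE exE) (rule that; assumption)
  have "A f w $ i = \<phi> w * f w $ i" for i
  proof -
    let ?k = "kernel_section K w (axis i 1)"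
    have "cball 0 r \<subseteq> ball (0 :: complex) R" using r by auto
    then have "((\<lambda>\<mu>. F \<mu> / (\<mu> - w)) has_contour_integral (2 * of_real pi * \<i> * F w)) (circlepath 0 r)"
      by (intro Cauchy_integral_circlepath_simple holomorphic_on_subset[OF F]) (use w r in auto)
    then have "((\<lambda>\<mu>. F \<mu> / (\<mu> - w) * f w $ i)
        has_contour_integral (2 * of_real pi * \<i> * F w * f w $ i)) (circlepath 0 r)"
      by (rule has_contour_integral_rmul)
    then have "((\<lambda>\<mu>. F \<mu> * ip (resolvent H mult_z \<mu> f) ?k)
        has_contour_integral (2 * of_real pi * \<i> * F w * f w $ i)) (circlepath 0 r)"
    proof (rule has_contour_integral_eq)
      fix \<mu> assume "\<mu> \<in> path_image (circlepath 0 r)"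
      then have \<mu>: "1 < cmod \<mu>" using r by auto
      then have ne: "\<mu> \<noteq> w" using w by auto
      have "(fscale \<mu> (resolvent H mult_z \<mu> f) - mult_z (resolvent H mult_z \<mu> f)) w $ i = f w $ i"
        by (simp only: resolvent_eq[OF \<mu> f])
      then have "(\<mu> - w) * resolvent H mult_z \<mu> f w $ i = f w $ i"
        by (simp add: mult_z_def algebra_simps)
      then show "F \<mu> / (\<mu> - w) * f w $ i = F \<mu> * ip (resolvent H mult_z \<mu> f) ?k"
        using ne reproducing[OF resolvent_mem[OF \<mu> f] w] by (simp add: cdot_axis field_simps)
    qed
    from has_contour_integral_unique[OF this int[rule_format, OF f kernel_section_mem[OF w]]]
    show ?thesis
      using w F\<phi> reproducing[OF bounded_op_mem[OF A f] w] by (simp add: cdot_axis)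
  qed
  then show ?thesis by (simp add: vec_eq_iff)
qed

text \<open>Strict positivity at the single point \<open>w\<close> gives an inverse \<open>C\<close> of \<open>K w w\<close>, and \<open>K(\<cdot>, w) C x\<close>
  takes the value \<open>x\<close> at \<open>w\<close>.\<close>

lemma evaluation_surjective:
  assumes K: "positive_definite_kernel K" and w: "w \<in> \<bbbD>"
  shows "det (K w w) \<noteq> 0" "\<exists>f\<in>H. f w = x"
proof -
  have "block_invertible {w} K"
    using K w unfolding positive_definite_kernel_def by blast
  then obtain C where "K w w ** C = mat 1"
    by (auto simp: block_invertible_def)
  then have C: "K w w ** C = mat 1" .
  then show "det (K w w) \<noteq> 0"
    using invertible_right_inverse invertible_det_nz by blast
  have "kernel_section K w (C *v x) w = x"
    using w C by (simp add: kernel_section_def matrix_vector_mul_assoc)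
  then show "\<exists>f\<in>H. f w = x" using kernel_section_mem[OF w] by blast
qed

text \<open>The adjoint is a definite description, so a vector that represents \<open>\<langle>T \<cdot>, g\<rangle>\<close> identifies \<open>T\<^sup>* g\<close>: it
  supplies existence, and definiteness of the inner product supplies uniqueness. In this way an
  eigenvector equation for the adjoint can be checked weakly.\<close>

lemma adj_eqI:
  assumes "h \<in> H" "g \<in> H" "\<And>f. f \<in> H \<Longrightarrow> ip (T f) g = ip f h"
  shows "adj H ip T g = h"
  unfolding adj_def
proof (rule the_equality)
  fix h' assume h': "h' \<in> H \<and> (\<forall>f\<in>H. ip (T f) g = ip f h')"
  have d: "h' - h \<in> H" using h' assms by (simp add: diff_mem)
  have "ip (h' - h) (h' - h) = 0"
    using h' assms d by (simp add: ip_diff_right)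
  then show "h' = h" using ip_definite[OF d] by simp
qed (use assms in blast)

text \<open>The adjoint of an intertwiner \<open>L M\<^sub>z = M\<^sub>\<phi> L\<close> maps \<open>K(\<cdot>, w)\<eta>\<close>, an eigenvector of \<open>M\<^sub>\<phi>\<^sup>*\<close> for \<open>cnj (\<phi> w)\<close>,
  to an eigenvector of \<open>M\<^sub>z\<^sup>*\<close> for \<open>cnj (\<phi> w)\<close>. Sharpness turns the latter into a kernel function at
  \<open>\<phi> w\<close>, which says that \<open>(L f)(w)\<close> depends on \<open>f(\<phi> w)\<close> only.\<close>

lemma intertwiner_evaluation:
  assumes sharp: "sharp_kernel K H ip" and L: "bounded_op H ip L"
    and inter: "\<And>f z. f \<in> H \<Longrightarrow> z \<in> \<bbbD> \<Longrightarrow> L (mult_z f) z = \<phi> z *s L f z"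
    and w: "w \<in> \<bbbD>" and \<phi>w: "\<phi> w \<in> \<bbbD>"
  shows "\<exists>\<xi>. \<forall>f\<in>H. cdot (L f w) \<eta> = cdot (f (\<phi> w)) \<xi>"
proof -
  have T: "bounded_op H ip mult_z" using sharp by (simp add: sharp_kernel_def)
  let ?k = "kernel_section K w \<eta>"
  have k: "?k \<in> H" by (rule kernel_section_mem[OF w])
  obtain C where C: "\<And>f. f \<in> H \<Longrightarrow> hnorm ip (L f) \<le> C * hnorm ip f"
    using bounded_op_bound[OF L] by metis
  have bound: "cmod (ip (L f) ?k) \<le> C * hnorm ip ?k * hnorm ip f" if f: "f \<in> H" for f
    using Cauchy_Schwarz[OF bounded_op_mem[OF L f] k] mult_right_mono[OF C[OF f] hnorm_nonneg[OF k]]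
    by (simp add: mult.commute mult.left_commute)
  have "\<exists>h\<in>H. \<forall>f\<in>H. ip (L f) ?k = ip f h"
    by (rule Riesz_representation[OF _ _ bound])
       (simp_all add: bounded_op_plus[OF L] bounded_op_fscale[OF L] bounded_op_mem[OF L] ip_add ip_scale k)
  then obtain h where h: "h \<in> H" and Lh: "\<And>f. f \<in> H \<Longrightarrow> ip (L f) ?k = ip f h" by blast
  have "adj H ip mult_z h = fscale (cnj (\<phi> w)) h"
  proof (rule adj_eqI)
    fix f assume f: "f \<in> H"
    have Tf: "mult_z f \<in> H" by (rule bounded_op_mem[OF T f])
    have "ip (mult_z f) h = cdot (L (mult_z f) w) \<eta>"
      using Lh[OF Tf] reproducing[OF bounded_op_mem[OF L Tf] w, of \<eta>] by simp
    also have "\<dots> = \<phi> w * cdot (L f w) \<eta>"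
      by (simp add: inter[OF f w] cdot_def sum_distrib_left mult.assoc)
    also have "cdot (L f w) \<eta> = ip f h"
      using Lh[OF f] reproducing[OF bounded_op_mem[OF L f] w, of \<eta>] by simp
    finally show "ip (mult_z f) h = ip f (fscale (cnj (\<phi> w)) h)"
      by (simp add: ip_scale_right f h)
  qed (simp_all add: h scale_mem)
  then have "h \<in> {f \<in> H. adj H ip mult_z f - fscale (cnj (\<phi> w)) f = 0}"
    using h by simp
  also have "\<dots> = range (kernel_section K (\<phi> w))"
    using sharp \<phi>w unfolding sharp_kernel_def by blast
  finally obtain \<xi> where "h = kernel_section K (\<phi> w) \<xi>" by blast
  then have "cdot (L f w) \<eta> = cdot (f (\<phi> w)) \<xi>" if f: "f \<in> H" for f
    using Lh[OF f] reproducing[OF bounded_op_mem[OF L f] w, of \<eta>] reproducing[OF f \<phi>w, of \<xi>]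
    that by simp
  then show ?thesis by blast
qed

text \<open>The weight \<open>g\<close> is recovered from the values of \<open>L\<close>: it is onto because \<open>L\<close> is, and near any point it
  solves a linear system built from \<open>n\<close> kernel functions and their images under \<open>L\<close>.\<close>

lemma intertwiner_is_weighted_comp:
  assumes K: "positive_definite_kernel K" and sharp: "sharp_kernel K H ip"
    and inv: "inverse_ops H ip L' L"
    and inter: "\<And>f z. f \<in> H \<Longrightarrow> z \<in> \<bbbD> \<Longrightarrow> L (mult_z f) z = \<phi> z *s L f z"
    and \<phi>: "\<phi> holomorphic_on \<bbbD>" and \<phi>D: "\<And>z. z \<in> \<bbbD> \<Longrightarrow> \<phi> z \<in> \<bbbD>"
  obtains g where "holomorphic_GL g" "\<And>f. f \<in> H \<Longrightarrow> weighted_comp g \<phi> f = L f"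
proof -
  have L: "bounded_op H ip L" and L': "bounded_op H ip L'"
    using inv by (auto simp: inverse_ops_def)
  have "\<exists>\<xi>. \<forall>f\<in>H. cdot (L f w) (axis i 1) = cdot (f (\<phi> w)) \<xi>" if "w \<in> \<bbbD>" for w i
    using intertwiner_evaluation[where \<phi> = \<phi>, OF sharp L inter that \<phi>D[OF that]] .
  then obtain \<xi> where \<xi>: "\<And>w i f. w \<in> \<bbbD> \<Longrightarrow> f \<in> H \<Longrightarrow> L f w $ i = cdot (f (\<phi> w)) (\<xi> w i)"
    unfolding cdot_axis by metis
  define g where "g w = (\<chi> i j. cnj (\<xi> w i $ j))" for w
  have g: "g w *v f (\<phi> w) = L f w" if "w \<in> \<bbbD>" "f \<in> H" for w f
    using \<xi>[OF that] by (simp add: g_def vec_eq_iff matrix_vector_mult_def cdot_def mult.commute)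
  have Lhol: "(\<lambda>z. L f z $ i) holomorphic_on \<bbbD>" if "f \<in> H" for f i
    by (rule holomorphic[OF bounded_op_mem[OF L that]])
  have "invertible (g w)" if w: "w \<in> \<bbbD>" for w
  proof -
    have "\<exists>y. g w *v y = x" for x
    proof -
      obtain f where f: "f \<in> H" "f w = x"
        using evaluation_surjective(2)[OF K w] by blast
      have "g w *v L' f (\<phi> w) = L (L' f) w" by (rule g[OF w bounded_op_mem[OF L' f(1)]])
      then show ?thesis using inv f by (auto simp: inverse_ops_def)
    qed
    then have "surj ((*v) (g w))" by (metis surjI surj_def)
    then show ?thesis
      by (simp add: matrix_right_invertible_surjective[symmetric] invertible_right_inverse)
  qed
  moreover have "(\<lambda>w. g w $ k $ i) holomorphic_on \<bbbD>" for k i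
  proof (rule holomorphic_onI)
    fix w0 :: complex assume w0: "w0 \<in> \<bbbD>"
    define p where "p = \<phi> w0"
    have p: "p \<in> \<bbbD>" using \<phi>D[OF w0] by (simp add: p_def)
    define e where "e j = kernel_section K p (axis j 1)" for j :: 'n
    have e: "e j \<in> H" for j unfolding e_def by (rule kernel_section_mem[OF p])
    define M where "M w = (\<chi> j l. e j (\<phi> w) $ l)" for w
    have "M w0 = transpose (K p p)"
    proof -
      have "(K p p *v axis j 1) $ l = K p p $ l $ j" for j l
        by (rule matrix_vector_mult_axis)
      then show ?thesis using p
        by (simp add: M_def e_def kernel_section_def p_def[symmetric] vec_eq_iff transpose_def)
    qed
    then have nz: "det (M w0) \<noteq> 0"
      using evaluation_surjective(1)[OF K p] by (simp add: det_transpose)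
    have Mhol: "(\<lambda>w. M w $ j $ l) holomorphic_on \<bbbD>" for j l
      using holomorphic_on_compose_gen[OF \<phi> holomorphic[OF e] image_subsetI[OF \<phi>D]]
      by (simp add: M_def o_def)
    have eq: "M w *v (g w $ k) = (\<chi> j. L (e j) w $ k)" if w: "w \<in> \<bbbD>" for w
      unfolding vec_eq_iff
    proof
      fix j
      have "(M w *v (g w $ k)) $ j = (g w *v e j (\<phi> w)) $ k"
        by (simp add: M_def matrix_vector_mult_def mult.commute)
      then show "(M w *v (g w $ k)) $ j = (\<chi> j. L (e j) w $ k) $ j"
        by (simp add: g[OF w e])
    qed
    have "(\<lambda>w. g w $ k $ i) field_differentiable at w0"
      by (rule holomorphic_solution[OF open_ball w0 Mhol _ eq nz]) (simp_all add: Lhol e)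
    then show "(\<lambda>w. g w $ k $ i) field_differentiable at w0 within \<bbbD>"
      by (rule field_differentiable_at_within)
  qed
  ultimately have "holomorphic_GL g" by (simp add: holomorphic_GL_def)
  moreover have "weighted_comp g \<phi> f = L f" if f: "f \<in> H" for f
    using g[OF _ f] zero_off_disc[OF bounded_op_mem[OF L f]]
    by (auto simp: weighted_comp_def fun_eq_iff)
  ultimately show ?thesis using that by blast
qed

text \<open>The intertwiner of \<open>M\<^sub>z\<close> and \<open>M\<^sub>\<psi>\<close> composes with \<open>\<psi>\<close>. Composition with the inverse of \<open>\<phi>\<close> thus comes from
  weak homogeneity at the inverse of \<open>\<phi>\<close>.\<close>

lemma weighted_composition_if_weakly_homogeneous:
  assumes K: "positive_definite_kernel K" and sharp: "sharp_kernel K H ip"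
    and hom: "weakly_homogeneous H ip mult_z" and \<phi>: "\<phi> \<in> Mob"
  shows "\<exists>g. holomorphic_GL g \<and> bounded_invertible_op H ip (weighted_comp g (inv_into \<bbbD> \<phi>))"
proof -
  let ?\<psi> = "inv_into \<bbbD> \<phi>"
  have \<psi>: "?\<psi> \<in> Mob" by (rule Mob_inv[OF \<phi>])
  have T: "bounded_op H ip mult_z" and spec: "op_spectrum H ip mult_z \<subseteq> cball 0 1"
    using hom by (auto simp: weakly_homogeneous_def)
  obtain A L L' where calc: "disc_calculus H ip mult_z ?\<psi> A" and inv: "inverse_ops H ip L' L"
    and sim: "\<And>f. f \<in> H \<Longrightarrow> A f = L (mult_z (L' f))"
    using hom \<psi> unfolding weakly_homogeneous_def similar_ops_def by metis
  have L: "bounded_op H ip L" using inv by (simp add: inverse_ops_def)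
  have inter: "L (mult_z f) z = ?\<psi> z *s L f z" if f: "f \<in> H" and z: "z \<in> \<bbbD>" for f z
  proof -
    have Lf: "L f \<in> H" by (rule bounded_op_mem[OF L f])
    have "L (mult_z f) z = A (L f) z"
      using sim[OF Lf] inv f by (simp add: inverse_ops_def)
    also have "\<dots> = ?\<psi> z *s L f z" by (rule disc_calculus_mult_z[OF T spec calc Lf z])
    finally show ?thesis .
  qed
  have "?\<psi> holomorphic_on \<bbbD>" using \<phi> by (simp add: Mob_def)
  then obtain g where g: "holomorphic_GL g" "\<And>f. f \<in> H \<Longrightarrow> weighted_comp g ?\<psi> f = L f"
    using intertwiner_is_weighted_comp[OF K sharp inv inter] Mob_mem[OF \<psi>] by metis
  have "inverse_ops H ip L' (weighted_comp g ?\<psi>)"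
    using inv g(2) bounded_op_cong[OF L g(2)] by (auto simp: inverse_ops_def bounded_op_mem)
  then show ?thesis using g(1) by (auto simp: bounded_invertible_op_def)
qed

end

theorem proposition2p8:
  fixes K :: "complex \<Rightarrow> complex \<Rightarrow> complex ^ 'n::finite ^ 'n"
    and H :: "'n vfun set"
    and ip :: "'n vfun \<Rightarrow> 'n vfun \<Rightarrow> complex"
  assumes "positive_definite_kernel K"
    and "rkhs K H ip"
    and "bounded_op H ip mult_z"
  shows "((\<forall>\<phi>\<in>Mob. \<exists>g. holomorphic_GL g \<and>
             bounded_invertible_op H ip (weighted_comp g (inv_into \<bbbD> \<phi>)))
           \<longrightarrow> weakly_homogeneous H ip mult_z)
       \<and> (sharp_kernel K H ip \<and> weakly_homogeneous H ip mult_z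
           \<longrightarrow> (\<forall>\<phi>\<in>Mob. \<exists>g. holomorphic_GL g \<and>
                 bounded_invertible_op H ip (weighted_comp g (inv_into \<bbbD> \<phi>))))"
proof -
  interpret rkhs K H ip by (rule assms(2))
  show ?thesis
    using weakly_homogeneous_if_weighted_compositions[OF assms(3)]
      weighted_composition_if_weakly_homogeneous[OF assms(1)] by blast
qed

end
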